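(* Let $n\ge1$ and let $\lambda_0,\dots,\lambda_{2n-1}$ be real numbers. Let $\alpha\in[0,1)$ and $\ell\in\mathbb{N}_0$, and assume that the basic limit function $\Phi^{D_{2n}}$ of the $2n$-point Deslauriers-Dubuc scheme satisfies, for some $\varepsilon>0$ and $C>0$, the inequality $$\left|\widehat{\Phi^{D_{2n}}}(\omega)\right|\le C(|\omega|+1)^{-\ell-1-\alpha-\varepsilon}\qquad\text{for all }\omega\in\mathbb{R}.$$ Then for every $m\in\mathbb{N}_0$ the basic limit function $\Phi_m^{\Lambda_{2n}}$ of the scheme $S_m^{\Lambda_{2n}}$ has its $\ell$-th derivative in $Lip(\alpha)$.
   Context: Fourier transform: $\widehat f(\omega)=\int_{-\infty}^\infty f(x)e^{-ix\omega}\,dx$. $Lip(\alpha)$ is the set of functions $f:\mathbb{R}\to\mathbb{C}$ for which there is $L>0$ with $|f(x)-f(y)|\le L|x-y|^\alpha$ for all $x,y$. A subdivision scheme is given by masks $(a_j^{[k]})_{j\in\mathbb{Z}}$, $k\in\mathbb{N}_0$, each finitely supported, with symbols $a^{[k]}(z)=\sum_ja_j^{[k]}z^j$. From initial data $f^0:\mathbb{Z}\to\mathbb{C}$ one defines $f_j^{k+1}=\sum_{l\in\mathbb{Z}}a_{j-2l}^{[k]}f_l^k$, where $f_j^k$ is regarded as the value at $j2^{-k}$. The scheme is convergent if for every bounded initial sequence there is a continuous $F:\mathbb{R}\to\mathbb{C}$ with $\lim_{k\to\infty}\sup_j|F(j2^{-k})-f_j^k|=0$; the limit function $F$ for the initial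 data $f_j^0=\delta_{0,j}$ is the basic limit function. For real $\lambda_0,\dots,\lambda_{2n-1}$ and $k\in\mathbb{N}_0$ let $a^{[k]}(z)=\sum_{|j|\le2n-1}a_j^{[k]}z^j$ be the unique Laurent polynomial of this form with $a^{[k]}(z)+a^{[k]}(-z)=2$ for all $z\neq0$ and $\frac{d^s}{dz^s}a^{[k]}\left(-\exp(-2^{-(k+1)}\lambda_j)\right)=0$ for $s=0,\dots,\mu_j-1$ and $j=0,\dots,2n-1$, where $\mu_j$ is the number of times the value $\lambda_j$ occurs in $(\lambda_0,\dots,\lambda_{2n-1})$. For $m\in\mathbb{N}_0$, $S_m^{\Lambda_{2n}}$ is the subdivision scheme whose symbol at level $k$ is $a^{[k+m]}(z)$, $k\in\mathbb{N}_0$. The $2n$-point Deslauriers-Dubuc scheme is the (stationary) special case $\lambda_0=\dots=\lambda_{2n-1}=0$. It is known that all these schemes are convergent, so their basic limit functions exist; they are continuous with compact support. *)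

theory Defs
  imports "HOL-Analysis.Analysis"
begin

text \<open>A mask is a finitely supported function \<open>int \<Rightarrow> complex\<close>. The sums below range over the
  nonzero coefficients, so they are the full bi-infinite sums for such masks.\<close>

definition symbol :: "(int \<Rightarrow> complex) \<Rightarrow> complex \<Rightarrow> complex" where
  "symbol c z = (\<Sum>j | c j \<noteq> 0. c j * z powi j)"

definition subdivide :: "(int \<Rightarrow> complex) \<Rightarrow> (int \<Rightarrow> complex) \<Rightarrow> int \<Rightarrow> complex" where
  "subdivide c f j = (\<Sum>l | c (j - 2 * l) \<noteq> 0. c (j - 2 * l) * f l)"

text \<open>A scheme is the sequence of its level-dependent masks.\<close>

primrec scheme_data :: "(nat \<Rightarrow> int \<Rightarrow> complex) \<Rightarrow> (int \<Rightarrow> complex) \<Rightarrow> nat \<Rightarrow> int \<Rightarrow> complex" where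
  "scheme_data a f0 0 = f0"
| "scheme_data a f0 (Suc k) = subdivide (a k) (scheme_data a f0 k)"

text \<open>The supremum is taken in \<open>ennreal\<close>, where it exists without a boundedness assumption.\<close>

definition is_limit_function ::
    "(nat \<Rightarrow> int \<Rightarrow> complex) \<Rightarrow> (int \<Rightarrow> complex) \<Rightarrow> (real \<Rightarrow> complex) \<Rightarrow> bool" where
  "is_limit_function a f0 F \<longleftrightarrow>
     continuous_on UNIV F \<and>
     (\<lambda>k. SUP j. ennreal (cmod (F (of_int j / 2 ^ k) - scheme_data a f0 k j))) \<longlonglongrightarrow> 0"

text \<open>A relation rather than a function: such an \<open>F\<close> is unique, being continuous and
  determined on the dyadic rationals.\<close>

definition is_basic_limit_function :: "(nat \<Rightarrow> int \<Rightarrow> complex) \<Rightarrow> (real \<Rightarrow> complex) \<Rightarrow> bool" where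
  "is_basic_limit_function a F \<longleftrightarrow> is_limit_function a (\<lambda>j. if j = 0 then 1 else 0) F"

definition multiplicity_in :: "nat \<Rightarrow> (nat \<Rightarrow> real) \<Rightarrow> nat \<Rightarrow> nat" where
  "multiplicity_in N lam j = card {i. i < N \<and> lam i = lam j}"

text \<open>Only the values \<open>lam 0, \<dots>, lam (2 * n - 1)\<close> matter. For every \<open>k\<close> exactly one mask
  satisfies this condition.\<close>

definition is_interpolatory_mask ::
    "nat \<Rightarrow> (nat \<Rightarrow> real) \<Rightarrow> nat \<Rightarrow> (int \<Rightarrow> complex) \<Rightarrow> bool" where
  "is_interpolatory_mask n lam k c \<longleftrightarrow>
     (\<forall>j. \<bar>j\<bar> > 2 * int n - 1 \<longrightarrow> c j = 0) \<and>
     (\<forall>z. z \<noteq> 0 \<longrightarrow> symbol c z + symbol c (- z) = 2) \<and>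
     (\<forall>j < 2 * n. \<forall>s < multiplicity_in (2 * n) lam j.
        (deriv ^^ s) (symbol c) (- complex_of_real (exp (- (lam j / 2 ^ (k + 1))))) = 0)"

definition is_interpolatory_scheme ::
    "nat \<Rightarrow> (nat \<Rightarrow> real) \<Rightarrow> (nat \<Rightarrow> int \<Rightarrow> complex) \<Rightarrow> bool" where
  "is_interpolatory_scheme n lam a \<longleftrightarrow> (\<forall>k. is_interpolatory_mask n lam k (a k))"

definition is_Deslauriers_Dubuc_scheme :: "nat \<Rightarrow> (nat \<Rightarrow> int \<Rightarrow> complex) \<Rightarrow> bool" where
  "is_Deslauriers_Dubuc_scheme n d \<longleftrightarrow> is_interpolatory_scheme n (\<lambda>_. 0) d"

definition fourier :: "(real \<Rightarrow> complex) \<Rightarrow> real \<Rightarrow> complex" where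
  "fourier f \<omega> = (LINT x|lborel. f x * exp (- (\<i> * of_real x * of_real \<omega>)))"

text \<open>Isabelle's \<open>0 powr 0 = 0\<close> is harmless here: for \<open>x = y\<close> the left-hand side vanishes.\<close>

definition Lip :: "real \<Rightarrow> (real \<Rightarrow> complex) set" where
  "Lip \<alpha> = {f. \<exists>L>0. \<forall>x y. cmod (f x - f y) \<le> L * \<bar>x - y\<bar> powr \<alpha>}"

primrec has_nth_derivative :: "nat \<Rightarrow> (real \<Rightarrow> complex) \<Rightarrow> (real \<Rightarrow> complex) \<Rightarrow> bool" where
  "has_nth_derivative 0 f g \<longleftrightarrow> g = f"
| "has_nth_derivative (Suc l) f g \<longleftrightarrow>
     (\<exists>h. (\<forall>x. (f has_vector_derivative h x) (at x)) \<and> has_nth_derivative l h g)"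

end

theory Submission
  imports Defs "HOL-Complex_Analysis.Complex_Analysis" "HOL-Probability.Probability"
    "HOL-Computational_Algebra.Polynomial_Factorial" "HOL-Computational_Algebra.Field_as_Ring"
begin

text \<open>The Fourier transform of a basic limit function is the infinite product of the halved symbols
  at \<open>exp (- \<i> \<omega> / 2\<^sup>k\<^sup>+\<^sup>1)\<close>. Each symbol splits into linear factors with the prescribed roots and a
  cofactor. The linear factors telescope to quotients like \<open>(exp (- \<i> \<omega>) - exp (- \<tau>)) / (\<tau> - \<i> \<omega>)\<close>,
  which decay like \<open>1 / \<bar>\<omega>\<bar>\<close> for every real \<open>\<tau>\<close>. The cofactors converge geometrically to the
  Deslauriers-Dubuc cofactor, which has no zeros on the unit circle, so the two products of cofactors
  are comparable, even at frequencies that differ by at most \<open>\<pi>\<close>. Moving to an odd multiple of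
  \<open>\<pi>\<close>, where the linear factors of the Deslauriers-Dubuc symbols do not vanish, transfers the decay
  of one Fourier transform to the other. Fourier inversion turns decay into smoothness.\<close>

section \<open>Stability of the cofactor\<close>

text \<open>The Deslauriers-Dubuc transform vanishes at every nonzero multiple of 2 pi, where the
  other transform need not vanish, so their quotient at equal frequencies is in general unbounded.
  This obstacle forces the comparison at shifted points. The shift is affordable because a
  displacement of at most pi changes the power-law majorant only by a constant factor and the
  level-k arguments only by O(2^-k). Each cofactor product alone may grow with the frequency; only
  the ratio of the two products is controlled. Its relative errors are summable over the levels, so
  the bound is uniform in the frequency and in the number of factors. The rate of convergence of the
  cofactors comes from a(z) + a(-z) = 2. With A the product of the linear factors and B the
  cofactor, \<open>A * B - reflect_arg (A * B)\<close> is the same monomial at every level, A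
  differs from (1 + z)^(2n) by O(2^-k), and at (1 + z)^(2n) this linear equation for B has a bounded
  inverse.\<close>

definition coeff_norm :: "complex poly \<Rightarrow> real" where
  "coeff_norm p = sum_list (map cmod (coeffs p))"

lemma coeff_norm_0 [simp]: "coeff_norm 0 = 0"
  by (simp add: coeff_norm_def)

lemma coeff_norm_pCons [simp]: "coeff_norm (pCons c p) = cmod c + coeff_norm p"
  by (auto simp: coeff_norm_def cCons_def)

lemma coeff_norm_nonneg [simp]: "0 \<le> coeff_norm p"
  by (induction p) auto

lemma coeff_norm_add: "coeff_norm (p + q) \<le> coeff_norm p + coeff_norm q"
  by (induction p q rule: poly_induct2) (auto intro: order_trans[OF add_mono[OF norm_triangle_ineq]])

lemma coeff_norm_smult [simp]: "coeff_norm (smult c p) = cmod c * coeff_norm p"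
  by (induction p) (auto simp: norm_mult algebra_simps)

lemma coeff_norm_minus [simp]: "coeff_norm (- p) = coeff_norm p"
  by (induction p) auto

lemma coeff_norm_diff: "coeff_norm (p - q) \<le> coeff_norm p + coeff_norm q"
  using coeff_norm_add[of p "- q"] by simp

lemma coeff_norm_mult: "coeff_norm (p * q) \<le> coeff_norm p * coeff_norm q"
proof (induction p)
  case (pCons c p)
  have "coeff_norm (pCons c p * q) \<le> coeff_norm (smult c q) + coeff_norm (pCons 0 (p * q))"
    by (simp only: mult_pCons_left coeff_norm_add)
  also have "\<dots> \<le> cmod c * coeff_norm q + coeff_norm p * coeff_norm q"
    using pCons.IH by simp
  finally show ?case by (simp add: algebra_simps)
qed simp

text \<open>This is why polynomials are measured by the sum of the moduli of their coefficients: the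
  norm is submultiplicative, invariant under z -> -z, and controls all values on the unit circle at
  once.\<close>

lemma norm_poly_le_coeff_norm: "cmod z \<le> 1 \<Longrightarrow> cmod (poly p z) \<le> coeff_norm p"
proof (induction p)
  case (pCons c p)
  have "cmod (poly (pCons c p) z) \<le> cmod c + cmod (z * poly p z)"
    using norm_triangle_ineq by simp
  also have "cmod (z * poly p z) \<le> 1 * coeff_norm p"
    unfolding norm_mult using pCons by (intro mult_mono) auto
  finally show ?case by simp
qed simp

lemma poly_Lipschitz_unit_disc:
  fixes p :: "complex poly"
  obtains L where "L \<ge> 0" "\<And>u v. cmod u \<le> 1 \<Longrightarrow> cmod v \<le> 1 \<Longrightarrow>
    cmod (poly p u - poly p v) \<le> L * cmod (u - v)"
proof -
  have "\<exists>L\<ge>0. \<forall>u v. cmod u \<le> 1 \<longrightarrow> cmod v \<le> 1 \<longrightarrow> cmod (poly p u - poly p v) \<le> L * cmod (u - v)"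
  proof (induction p)
    case 0
    then show ?case by auto
  next
    case (pCons c p)
    then obtain L where L: "L \<ge> 0"
      "\<And>u v. cmod u \<le> 1 \<Longrightarrow> cmod v \<le> 1 \<Longrightarrow> cmod (poly p u - poly p v) \<le> L * cmod (u - v)"
      by blast
    show ?case
    proof (intro exI[of _ "L + coeff_norm p"] conjI allI impI)
      show "0 \<le> L + coeff_norm p" using L by simp
      fix u v assume uv: "cmod u \<le> 1" "cmod v \<le> 1"
      have "poly (pCons c p) u - poly (pCons c p) v
          = u * (poly p u - poly p v) + (u - v) * poly p v"
        by (simp add: algebra_simps)
      also have "cmod \<dots> \<le> cmod u * cmod (poly p u - poly p v) + cmod (u - v) * cmod (poly p v)"
        using norm_triangle_ineq by (metis norm_mult)
      also have "\<dots> \<le> 1 * (L * cmod (u - v)) + cmod (u - v) * coeff_norm p"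
        using L uv by (intro add_mono mult_mono norm_poly_le_coeff_norm) auto
      finally show "cmod (poly (pCons c p) u - poly (pCons c p) v) \<le> (L + coeff_norm p) * cmod (u - v)"
        by (simp add: algebra_simps)
    qed
  qed
  then show ?thesis using that by blast
qed

abbreviation reflect_arg :: "complex poly \<Rightarrow> complex poly" where
  "reflect_arg p \<equiv> pcompose p [:0, - 1:]"

lemma coeff_norm_reflect_arg [simp]: "coeff_norm (reflect_arg p) = coeff_norm p"
proof (induction p)
  case (pCons c p)
  have "reflect_arg (pCons c p) = pCons c (- reflect_arg p)"
    by (simp add: pcompose_pCons)
  then show ?case using pCons by simp
qed simp

text \<open>The map from R to the remainder is linear on a finite-dimensional space, hence bounded.
  The induction strips the constant coefficient of \<open>R\<close> and moves the remaining factor x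
  into \<open>U\<close>, so \<open>U\<close> has to be arbitrary.\<close>

lemma coeff_norm_mult_mod_bound:
  fixes U M :: "complex poly"
  shows "\<exists>K\<ge>0. \<forall>R. degree R \<le> N \<longrightarrow> coeff_norm ((U * R) mod M) \<le> K * coeff_norm R"
proof (induction N arbitrary: U)
  case 0
  show ?case
  proof (intro exI[of _ "coeff_norm (U mod M)"] conjI allI impI)
    fix R :: "complex poly" assume "degree R \<le> 0"
    then obtain c where "R = [:c:]" by (metis degree_0_id le_zero_eq)
    then show "coeff_norm ((U * R) mod M) \<le> coeff_norm (U mod M) * coeff_norm R"
      by (simp add: mod_smult_left mult.commute)
  qed simp
next
  case (Suc N)
  obtain K where K: "K \<ge> 0"
    "\<And>R. degree R \<le> N \<Longrightarrow> coeff_norm ((U * [:0, 1:] * R) mod M) \<le> K * coeff_norm R"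
    using Suc[of "U * [:0, 1:]"] by blast
  show ?case
  proof (intro exI[of _ "coeff_norm (U mod M) + K"] conjI allI impI)
    fix R :: "complex poly" assume R: "degree R \<le> Suc N"
    obtain c R' where c: "R = pCons c R'" by (cases R)
    have "degree R' \<le> N" using R c by (auto split: if_splits)
    have "U * R = smult c U + U * [:0, 1:] * R'"
      by (simp add: c)
    then have "(U * R) mod M = smult c (U mod M) + (U * [:0, 1:] * R') mod M"
      by (simp add: poly_mod_add_left mod_smult_left)
    then have "coeff_norm ((U * R) mod M) \<le> cmod c * coeff_norm (U mod M) + K * coeff_norm R'"
      using coeff_norm_add[of "smult c (U mod M)"] K(2)[OF \<open>degree R' \<le> N\<close>]
      by (smt (verit) coeff_norm_smult)
    also have "\<dots> \<le> (coeff_norm (U mod M) + K) * (cmod c + coeff_norm R')"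
      using K by (simp add: algebra_simps)
    finally show "coeff_norm ((U * R) mod M) \<le> (coeff_norm (U mod M) + K) * coeff_norm R"
      by (simp add: c)
  qed (use K in simp)
qed

text \<open>The factors are exchanged one at a time, each of norm at most 2 + M. The cap
  \<open>M\<close> is kept apart from \<open>\<delta>\<close> so that the constant stays fixed while
  \<open>\<delta>\<close> shrinks with the level.\<close>

lemma coeff_norm_prod_linear_diff:
  fixes x :: "nat \<Rightarrow> complex"
  assumes "\<And>j. j < N \<Longrightarrow> cmod (x j - 1) \<le> \<delta>" and "\<delta> \<le> M" and "0 \<le> \<delta>"
  shows "coeff_norm ((\<Prod>j<N. [:x j, 1:]) - [:1, 1:] ^ N) \<le> real N * (2 + M) ^ N * \<delta>"
  using assms(1)
proof (induction N)
  case (Suc N)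
  let ?P = "\<Prod>j<N. [:x j, 1:]" and ?Q = "[:1, 1:] ^ N :: complex poly"
  have x: "cmod (x N - 1) \<le> \<delta>" using Suc.prems by simp
  then have xN: "cmod (x N) + 1 \<le> 2 + M"
    using norm_triangle_ineq2[of "x N" 1] assms by simp
  have Q: "coeff_norm ?Q \<le> 2 ^ N"
  proof (induction N)
    case (Suc N)
    have "coeff_norm ([:1, 1:] ^ Suc N) \<le> coeff_norm [:1, 1:] * coeff_norm ([:1, 1:] ^ N)"
      using coeff_norm_mult by (metis power_Suc)
    also have "\<dots> \<le> 2 * 2 ^ N" using Suc by (intro mult_mono) auto
    finally show ?case by simp
  qed (simp add: one_pCons)
  have "(\<Prod>j<Suc N. [:x j, 1:]) - [:1, 1:] ^ Suc N = (?P - ?Q) * [:x N, 1:] + ?Q * [:x N - 1:]"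
  proof -
    have "[:x N, 1:] = [:1, 1:] + [:x N - 1:]" by simp
    then show ?thesis
      by (simp only: prod.lessThan_Suc power_Suc ring_distribs) (simp add: algebra_simps)
  qed
  also have "coeff_norm \<dots> \<le> coeff_norm (?P - ?Q) * coeff_norm [:x N, 1:] + coeff_norm ?Q * coeff_norm [:x N - 1:]"
    by (intro order_trans[OF coeff_norm_add] add_mono coeff_norm_mult)
  also have "\<dots> \<le> (real N * (2 + M) ^ N * \<delta>) * (2 + M) + (2 + M) ^ N * \<delta>"
  proof (intro add_mono mult_mono)
    show "coeff_norm ?Q \<le> (2 + M) ^ N"
      using Q power_mono[of 2 "2 + M" N] assms by linarith
  qed (use Suc assms x xN in auto)
  also have "\<dots> \<le> (real N * (2 + M) ^ N * \<delta>) * (2 + M) + (2 + M) ^ N * \<delta> * (2 + M)"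
    using assms mult_left_mono[of 1 "2 + M" "(2 + M) ^ N * \<delta>"] by auto
  finally show ?case by (simp add: algebra_simps)
qed simp

lemma degree_reflect_arg [simp]: "degree (reflect_arg p) = degree p"
  by (simp add: degree_pcompose)

lemma reflect_arg_linear_power: "reflect_arg ([:1, 1:] ^ N) = [:1, -1:] ^ N"
  by (induction N) (simp_all only: power_0 power_Suc pcompose_1 pcompose_mult, simp add: pcompose_pCons)

lemma coprime_linear_power_reflect:
  "coprime ([:1, 1:] ^ N :: complex poly) ([:1, -1:] ^ N)"
proof -
  have "coprime [:1, 1:] ([:1, -1:] :: complex poly)"
  proof (rule coprimeI)
    fix q :: "complex poly" assume "q dvd [:1, 1:]" "q dvd [:1, -1:]"
    then have "q dvd [:1, 1:] + [:1, -1:]" by (rule dvd_add)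
    then have "q dvd [:2:]" by simp
    then show "is_unit q" by (rule dvd_trans) (simp add: is_unit_pCons_iff)
  qed
  then show ?thesis by (simp only: coprime_power_left_iff coprime_power_right_iff) simp
qed

text \<open>The functional equation determines the cofactor: reducing it modulo the reflected factor
  recovers \<open>D\<close> linearly from the right-hand side.\<close>

lemma cofactor_bound:
  "\<exists>K\<ge>0. \<forall>D. degree D < 2 * n \<longrightarrow>
     coeff_norm D \<le> K * coeff_norm ([:1, 1:] ^ (2 * n) * D - reflect_arg ([:1, 1:] ^ (2 * n) * D))"
proof -
  define P Q where "P = ([:1, 1:] ^ (2 * n) :: complex poly)" and "Q = reflect_arg P"
  have dP: "degree P = 2 * n" unfolding P_def by (subst degree_power_eq) auto
  have "coprime P Q" unfolding Q_def P_def reflect_arg_linear_power by (rule coprime_linear_power_reflect)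
  then have gcd: "gcd P Q = 1" by (rule coprime_imp_gcd_eq_1)
  obtain U V where UV: "U * P + V * Q = 1"
    using that[OF bezout_coefficients_fst_snd[of P Q, unfolded gcd]] .
  \<comment> \<open>The residual of \<open>D\<close> has degree at most deg P + deg D < 4n.\<close>
  obtain K where K: "K \<ge> 0" "\<And>R. degree R \<le> 4 * n \<Longrightarrow> coeff_norm ((U * R) mod Q) \<le> K * coeff_norm R"
    using coeff_norm_mult_mod_bound by meson
  have "coeff_norm D \<le> K * coeff_norm (P * D - reflect_arg (P * D))" if D: "degree D < 2 * n" for D
  proof -
    let ?R = "P * D - reflect_arg (P * D)"
    have "U * ?R = U * P * D - U * Q * reflect_arg D"
      by (simp add: Q_def pcompose_mult algebra_simps)
    also have "U * P = 1 - V * Q" using UV by (simp add: algebra_simps)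
    finally have "U * ?R = D + Q * (- V * D - U * reflect_arg D)"
      by (simp add: algebra_simps)
    then have "(U * ?R) mod Q = D mod Q" by (metis mod_mult_self2)
    also have "\<dots> = D" using D dP by (intro mod_poly_less) (simp add: Q_def)
    finally have "(U * ?R) mod Q = D" .
    moreover have "degree ?R \<le> 4 * n"
    proof -
      have "degree (P * D) \<le> 4 * n" using degree_mult_le[of P D] dP D by linarith
      then show ?thesis by (intro degree_diff_le) auto
    qed
    ultimately show ?thesis using K(2)[of ?R] by simp
  qed
  then show ?thesis using K(1) unfolding P_def by blast
qed

text \<open>Subtracting the two functional equations bounds \<open>B k - B0\<close> by O(2^-k) times
  the norm of \<open>B k\<close> itself. For large k this is absorbed, so no prior bound on
  \<open>B k\<close> is required.\<close>

lemma cofactor_stability: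
  fixes A B :: "nat \<Rightarrow> complex poly" and B0 T :: "complex poly"
  assumes eq: "\<And>k. A k * B k - reflect_arg (A k * B k) = T"
    and eq0: "[:1, 1:] ^ (2 * n) * B0 - reflect_arg ([:1, 1:] ^ (2 * n) * B0) = T"
    and deg: "\<And>k. degree (B k) < 2 * n" "degree B0 < 2 * n"
    and close: "\<And>k. coeff_norm (A k - [:1, 1:] ^ (2 * n)) \<le> c * (1/2) ^ k"
  shows "\<exists>K\<ge>0. \<forall>k. coeff_norm (B k - B0) \<le> K * (1/2) ^ k"
proof -
  define P where "P = ([:1, 1:] ^ (2 * n) :: complex poly)"
  obtain K where K: "K \<ge> 0" "\<And>D. degree D < 2 * n \<Longrightarrow>
     coeff_norm D \<le> K * coeff_norm (P * D - reflect_arg (P * D))"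
    using cofactor_bound[of n] unfolding P_def by blast
  have c: "c \<ge> 0" using order_trans[OF coeff_norm_nonneg close[of 0]] by simp
  have main: "coeff_norm (B k - B0) \<le> 2 * K * c * (1/2) ^ k * coeff_norm (B k)" for k
  proof -
    let ?D = "B k - B0" and ?E = "A k - P"
    have "P * ?D - reflect_arg (P * ?D) = reflect_arg (?E * B k) - ?E * B k"
    proof -
      have "P * ?D - reflect_arg (P * ?D) - (reflect_arg (?E * B k) - ?E * B k)
          = (A k * B k - reflect_arg (A k * B k)) - (P * B0 - reflect_arg (P * B0))"
        by (simp add: pcompose_diff pcompose_mult algebra_simps)
      also have "\<dots> = 0" using eq[of k] eq0 by (simp add: P_def)
      finally show ?thesis by simp
    qed
    then have "coeff_norm ?D \<le> K * coeff_norm (reflect_arg (?E * B k) - ?E * B k)"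
      using K(2)[of ?D] deg degree_diff_less by metis
    also have "\<dots> \<le> K * (2 * (coeff_norm ?E * coeff_norm (B k)))"
      using order_trans[OF coeff_norm_diff, of "reflect_arg (?E * B k)" "?E * B k"]
        coeff_norm_mult[of ?E "B k"] K(1)
      by (intro mult_left_mono) auto
    also have "\<dots> \<le> K * (2 * (c * (1/2) ^ k * coeff_norm (B k)))"
      using close[of k] K(1) unfolding P_def by (intro mult_left_mono mult_right_mono) auto
    finally show ?thesis by (simp add: algebra_simps)
  qed
  have "(\<lambda>k. 2 * K * c * (1/2::real) ^ k) \<longlonglongrightarrow> 2 * K * c * 0"
    by (intro tendsto_mult_left LIMSEQ_realpow_zero) auto
  then have "\<forall>\<^sub>F k in sequentially. 2 * K * c * (1/2) ^ k < 1/2"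
    by (intro order_tendstoD(2)[where y = 0]) auto
  then obtain k0 where k0: "\<And>k. k \<ge> k0 \<Longrightarrow> 2 * K * c * (1/2) ^ k < 1/2"
    unfolding eventually_sequentially by blast
  define G where "G k = coeff_norm (B k - B0) * 2 ^ k" for k
  \<comment> \<open>The sum over i < k0 is a crude cover for the finitely many levels at which the
    factor is not yet below 1/2.\<close>
  have "G k \<le> 4 * K * c * coeff_norm B0 + (\<Sum>i<k0. G i)" for k
  proof (cases "k < k0")
    case True
    then have "G k \<le> (\<Sum>i<k0. G i)"
      by (intro member_le_sum) (auto simp: G_def)
    moreover have "0 \<le> 4 * K * c * coeff_norm B0" using K c by simp
    ultimately show ?thesis by linarith
  next
    case False
    have "coeff_norm (B k) \<le> coeff_norm (B k - B0) + coeff_norm B0"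
      using coeff_norm_add[of "B k - B0" B0] by simp
    \<comment> \<open>With the factor 1/2 the triangle inequality closes up: the norm of
      \<open>B k\<close> is at most twice that of \<open>B0\<close>.\<close>
    also have "coeff_norm (B k - B0) \<le> 1/2 * coeff_norm (B k)"
      using order_trans[OF main[of k] mult_right_mono[of "2 * K * c * (1/2) ^ k" "1/2"]] k0[of k] False
      by (simp add: less_imp_le)
    finally have "coeff_norm (B k) \<le> 2 * coeff_norm B0" by simp
    then have "coeff_norm (B k - B0) \<le> 2 * K * c * (1/2) ^ k * (2 * coeff_norm B0)"
      using K c by (intro order_trans[OF main[of k]] mult_left_mono) auto
    then have "G k \<le> 2 * K * c * (1/2) ^ k * (2 * coeff_norm B0) * 2 ^ k"
      unfolding G_def by (intro mult_right_mono) auto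
    also have "\<dots> = 4 * K * c * coeff_norm B0"
      by (simp add: field_simps)
    finally have "G k \<le> 4 * K * c * coeff_norm B0" .
    moreover have "0 \<le> (\<Sum>i<k0. G i)" by (intro sum_nonneg) (auto simp: G_def)
    ultimately show ?thesis by linarith
  qed
  moreover have "0 \<le> 4 * K * c * coeff_norm B0 + (\<Sum>i<k0. G i)"
    using K c by (intro add_nonneg_nonneg sum_nonneg) (auto simp: G_def)
  ultimately show ?thesis
    unfolding G_def by (intro exI conjI) (auto simp: field_simps)
qed

section \<open>Factorization of interpolatory symbols\<close>

text \<open>One half of the binomial expansion of \<open>(V + W)\<^sup>2\<^sup>n\<^sup>-\<^sup>1 = (4 z)\<^sup>2\<^sup>n\<^sup>-\<^sup>1\<close> for \<open>V = -(1 - z)\<^sup>2\<close> and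
  \<open>W = (1 + z)\<^sup>2\<close>, divided by \<open>W\<^sup>n\<close>. The substitution \<open>z \<mapsto> -z\<close> sends \<open>(V, W)\<close> to \<open>(-W, -V)\<close> and so
  exchanges the two halves.\<close>

definition dd_cofactor :: "nat \<Rightarrow> complex poly" where
  "dd_cofactor n = smult (2 / 4 ^ (2 * n - 1))
     (\<Sum>k<n. smult (of_nat ((2 * n - 1) choose k))
        ((- ([:1, -1:] ^ 2)) ^ k * ([:1, 1:] ^ 2) ^ (n - 1 - k)))"

text \<open>The exponent is odd, so the 2n terms split evenly, and k -> 2n - 1 - k carries the upper
  half to the lower one with a and b exchanged.\<close>

lemma binomial_ring_halves:
  fixes a b :: "'a :: comm_ring_1"
  assumes "n \<ge> 1"
  shows "(a + b) ^ (2 * n - 1) =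
    (\<Sum>k<n. of_nat ((2 * n - 1) choose k) * a ^ k * b ^ (2 * n - 1 - k)) +
    (\<Sum>k<n. of_nat ((2 * n - 1) choose k) * b ^ k * a ^ (2 * n - 1 - k))"
proof -
  define N where "N = 2 * n - 1"
  have N: "N + 1 = 2 * n" using assms by (simp add: N_def)
  have "(a + b) ^ N = (\<Sum>k\<le>N. of_nat (N choose k) * a ^ k * b ^ (N - k))"
    by (rule binomial_ring)
  also have "{..N} = {..<n} \<union> {n..N}" using assms by (auto simp: N_def)
  also have "(\<Sum>k\<in>{..<n} \<union> {n..N}. of_nat (N choose k) * a ^ k * b ^ (N - k)) =
     (\<Sum>k<n. of_nat (N choose k) * a ^ k * b ^ (N - k)) +
     (\<Sum>k\<in>{n..N}. of_nat (N choose k) * a ^ k * b ^ (N - k))"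
    by (rule sum.union_disjoint) auto
  also have "(\<Sum>k\<in>{n..N}. of_nat (N choose k) * a ^ k * b ^ (N - k)) =
     (\<Sum>k<n. of_nat (N choose k) * b ^ k * a ^ (N - k))"
    by (rule sum.reindex_bij_witness[where i = "\<lambda>k. N - k" and j = "\<lambda>k. N - k"])
       (use N in \<open>auto simp: mult_ac binomial_symmetric[symmetric]\<close>)
  finally show ?thesis by (simp add: N_def)
qed

lemma poly_dd_cofactor:
  "poly (dd_cofactor n) z = 2 / 4 ^ (2 * n - 1) *
     (\<Sum>k<n. of_nat ((2 * n - 1) choose k) * (- ((1 - z) ^ 2)) ^ k * ((1 + z) ^ 2) ^ (n - 1 - k))"
  by (simp add: dd_cofactor_def poly_sum mult.assoc)

text \<open>The identity is a(z) + a(-z) = 2 multiplied by z^(2n-1); the odd exponent turns the sum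
  into a difference.\<close>

lemma dd_cofactor_functional_equation:
  assumes n: "n \<ge> 1"
  shows "[:1, 1:] ^ (2 * n) * dd_cofactor n - reflect_arg ([:1, 1:] ^ (2 * n) * dd_cofactor n)
    = monom 2 (2 * n - 1)"
proof (rule poly_ext)
  fix z :: complex
  define N V W c where "N = 2 * n - 1" and "V = - ((1 - z) ^ 2)" and "W = (1 + z) ^ 2"
    and "c = 2 / (4 :: complex) ^ N"
  have 1: "(1 + z) ^ (2 * n) * poly (dd_cofactor n) z =
      c * (\<Sum>k<n. of_nat (N choose k) * V ^ k * W ^ (N - k))"
  proof -
    have *: "W ^ n * W ^ (n - 1 - k) = W ^ (N - k)" if "k < n" for k
      using that n by (simp add: N_def mult_2 flip: power_add)
    have "(1 + z) ^ (2 * n) = W ^ n" by (simp add: W_def power_mult)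
    moreover have "poly (dd_cofactor n) z =
       c * (\<Sum>k<n. of_nat (N choose k) * V ^ k * W ^ (n - 1 - k))"
      by (simp add: poly_dd_cofactor V_def W_def N_def c_def)
    ultimately have "(1 + z) ^ (2 * n) * poly (dd_cofactor n) z =
        c * (\<Sum>k<n. of_nat (N choose k) * V ^ k * (W ^ n * W ^ (n - 1 - k)))"
      by (simp only: sum_distrib_left mult_ac)
    then show ?thesis using * by simp
  qed
  have 2: "(1 - z) ^ (2 * n) * poly (dd_cofactor n) (- z) =
      - c * (\<Sum>k<n. of_nat (N choose k) * W ^ k * V ^ (N - k))"
  proof -
    have *: "(- V) ^ n * ((- W) ^ k * (- V) ^ (n - 1 - k)) = - (W ^ k * V ^ (N - k))" if "k < n" for k
    proof -
      have "(- V) ^ n * ((- W) ^ k * (- V) ^ (n - 1 - k)) = (- W) ^ k * (- V) ^ (N - k)"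
        using that n by (simp add: N_def mult_ac mult_2_right flip: power_add)
      also have "\<dots> = (-1) ^ (k + (N - k)) * (W ^ k * V ^ (N - k))"
        by (subst (1 2) power_minus) (simp add: power_add mult_ac)
      \<comment> \<open>\<open>N\<close> is odd. This sign turns the difference with the reflected
        term into the sum of the two binomial halves.\<close>
      also have "(-1) ^ (k + (N - k)) = (-1 :: complex)"
        using that n by (simp add: N_def)
      finally show ?thesis by simp
    qed
    have "(1 - z) ^ (2 * n) = (- V) ^ n" by (simp add: V_def power_mult)
    moreover have "poly (dd_cofactor n) (- z) =
       c * (\<Sum>k<n. of_nat (N choose k) * (- W) ^ k * (- V) ^ (n - 1 - k))"
      by (simp add: poly_dd_cofactor V_def W_def N_def c_def)
    ultimately have "(1 - z) ^ (2 * n) * poly (dd_cofactor n) (- z) =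
        c * (\<Sum>k<n. of_nat (N choose k) * ((- V) ^ n * ((- W) ^ k * (- V) ^ (n - 1 - k))))"
      by (simp only: sum_distrib_left mult_ac)
    then show ?thesis using * by (simp add: mult_ac sum_negf)
  qed
  have VW: "V + W = 4 * z" by (simp add: V_def W_def power2_eq_square algebra_simps)
  have "poly ([:1, 1:] ^ (2 * n) * dd_cofactor n - reflect_arg ([:1, 1:] ^ (2 * n) * dd_cofactor n)) z
     = (1 + z) ^ (2 * n) * poly (dd_cofactor n) z - (1 - z) ^ (2 * n) * poly (dd_cofactor n) (- z)"
    by (simp add: poly_pcompose)
  also have "\<dots> = c * (V + W) ^ N"
    unfolding 1 2 N_def binomial_ring_halves[OF n] by (simp add: algebra_simps)
  also have "\<dots> = 2 * z ^ N" by (simp add: VW power_mult_distrib c_def)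
  finally show "poly ([:1, 1:] ^ (2 * n) * dd_cofactor n - reflect_arg ([:1, 1:] ^ (2 * n) * dd_cofactor n)) z
     = poly (monom 2 (2 * n - 1)) z"
    by (simp add: poly_monom N_def)
qed

lemma degree_dd_cofactor:
  assumes "n \<ge> 1"
  shows "degree (dd_cofactor n) < 2 * n"
proof -
  have "degree (dd_cofactor n) \<le> 2 * n - 2"
    unfolding dd_cofactor_def
  proof (intro order_trans[OF degree_smult_le] degree_sum_le)
    fix k assume k: "k \<in> {..<n}"
    have "degree ((- ([:1, -1:] ^ 2)) ^ k * ([:1, 1:] ^ 2) ^ (n - 1 - k) :: complex poly)
        \<le> 2 * k + 2 * (n - 1 - k)"
    proof (intro order_trans[OF degree_mult_le] add_mono order_trans[OF degree_power_le])
      show "degree (- ([:1, -1:] ^ 2) :: complex poly) * k \<le> 2 * k"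
        using degree_power_le[of "[:1, -1:] :: complex poly" 2] by simp
      show "degree ([:1, 1:] ^ 2 :: complex poly) * (n - 1 - k) \<le> 2 * (n - 1 - k)"
        using degree_power_le[of "[:1, 1:] :: complex poly" 2] by simp
    qed
    then show "degree ((- ([:1, -1:] ^ 2)) ^ k * ([:1, 1:] ^ 2) ^ (n - 1 - k) :: complex poly) \<le> 2 * n - 2"
      using k by auto
  qed simp
  then show ?thesis using assms by linarith
qed

text \<open>On the unit circle \<open>(1 + z)\<^sup>2 = z (2 + 2 Re z)\<close> and \<open>-(1 - z)\<^sup>2 = z (2 - 2 Re z)\<close>, so up to a
  power of \<open>z\<close> all summands of the cofactor are nonnegative.\<close>

lemma dd_cofactor_nonzero:
  assumes n: "n \<ge> 1" and z: "cmod z = 1"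
  shows "poly (dd_cofactor n) z \<noteq> 0"
proof -
  define s t where "s = 2 - 2 * Re z" and "t = 2 + 2 * Re z"
  have "\<bar>Re z\<bar> \<le> 1" using abs_Re_le_cmod[of z] z by simp
  then have st: "s \<ge> 0" "t \<ge> 0" "s + t = 4" by (auto simp: s_def t_def)
  have zz: "z * cnj z = 1" using z by (simp add: complex_norm_square[symmetric])
  have re: "2 * of_real (Re z) = z + cnj z" by (simp add: complex_add_cnj)
  have V: "- ((1 - z) ^ 2) = z * of_real s"
  proof -
    have "z * of_real s = 2 * z - z * (z + cnj z)"
      unfolding re[symmetric] by (simp add: s_def algebra_simps)
    also have "\<dots> = - ((1 - z) ^ 2)" using zz by (simp add: power2_eq_square algebra_simps)
    finally show ?thesis by simp
  qed
  have W: "(1 + z) ^ 2 = z * of_real t"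
  proof -
    have "z * of_real t = 2 * z + z * (z + cnj z)"
      unfolding re[symmetric] by (simp add: t_def algebra_simps)
    also have "\<dots> = (1 + z) ^ 2" using zz by (simp add: power2_eq_square algebra_simps)
    finally show ?thesis by simp
  qed
  define S where "S = (\<Sum>k<n. real ((2 * n - 1) choose k) * s ^ k * t ^ (n - 1 - k))"
  have "(\<Sum>k<n. of_nat ((2 * n - 1) choose k) * (z * of_real s) ^ k * (z * of_real t) ^ (n - 1 - k))
     = z ^ (n - 1) * of_real S"
  proof -
    have "of_nat ((2 * n - 1) choose k) * (z * of_real s) ^ k * (z * of_real t) ^ (n - 1 - k)
       = z ^ (n - 1) * of_real (real ((2 * n - 1) choose k) * s ^ k * t ^ (n - 1 - k))" if "k < n" for k
    proof -
      have "z ^ (n - 1) = z ^ k * z ^ (n - 1 - k)" using that by (simp flip: power_add)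
      then show ?thesis by (simp add: power_mult_distrib mult_ac)
    qed
    then show ?thesis unfolding S_def of_real_sum sum_distrib_left by (intro sum.cong) auto
  qed
  moreover have "S > 0"
  proof -
    have nn: "0 \<le> real ((2 * n - 1) choose k) * s ^ k * t ^ (n - 1 - k)" for k
      using st by simp
    \<comment> \<open>As s + t = 4, at most one of them vanishes. For t = 0 (that is, z = -1) the
      term k = n - 1 survives through 0^0 = 1; otherwise k = 0 does.\<close>
    have "\<exists>k<n. 0 < real ((2 * n - 1) choose k) * s ^ k * t ^ (n - 1 - k)"
    proof (cases "t = 0")
      case True
      then show ?thesis using st n by (intro exI[of _ "n - 1"]) auto
    next
      case False
      then show ?thesis using st n by (intro exI[of _ 0]) auto
    qed
    then show ?thesis unfolding S_def using nn by (auto intro: sum_pos2)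
  qed
  moreover have "z \<noteq> 0" using z by auto
  ultimately show ?thesis
    unfolding poly_dd_cofactor V W by simp
qed

text \<open>In the Leibniz sum the derivatives of (z - w)^s of order below s vanish at w, and the
  one of order s equals s!.\<close>

lemma higher_deriv_power_mult:
  assumes g: "g holomorphic_on S" and S: "open S" "w \<in> S"
  shows "(deriv ^^ s) (\<lambda>z. (z - w) ^ s * g z) w = fact s * g w"
proof -
  have "(deriv ^^ s) (\<lambda>z. (z - w) ^ s * g z) w =
      (\<Sum>i = 0..s. of_nat (s choose i) * (deriv ^^ i) (\<lambda>z. (z - w) ^ s) w * (deriv ^^ (s - i)) g w)"
    using assms by (intro higher_deriv_mult) (auto intro!: holomorphic_intros)
  also have "\<dots> = (\<Sum>i = 0..s. if i = s then fact s * g w else 0)"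
    by (intro sum.cong) (auto simp: higher_deriv_power simp flip: pochhammer_fact)
  finally show ?thesis by simp
qed

text \<open>If w were a root of order s < \<open>\<mu>\<close>, the s-th derivative of f at w would
  be s! times a nonzero value. A symbol is a Laurent polynomial, so the argument stays on the
  punctured plane and the value of f at 0 is irrelevant.\<close>

lemma dvd_of_higher_deriv_zero:
  fixes f :: "complex \<Rightarrow> complex" and p :: "complex poly"
  assumes fp: "\<And>z. z \<noteq> 0 \<Longrightarrow> f z * z ^ N = poly p z" and w: "w \<noteq> 0"
    and zero: "\<And>s. s < \<mu> \<Longrightarrow> (deriv ^^ s) f w = 0"
  shows "[:- w, 1:] ^ \<mu> dvd p"
proof (rule ccontr)
  assume neg: "\<not> [:- w, 1:] ^ \<mu> dvd p"
  then have "p \<noteq> 0" by auto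
  define s where "s = order w p"
  obtain q where q: "p = [:- w, 1:] ^ s * q" "\<not> [:- w, 1:] dvd q"
    using order_decomp[OF \<open>p \<noteq> 0\<close>] unfolding s_def by blast
  have "s < \<mu>" using neg \<open>p \<noteq> 0\<close> unfolding s_def order_divides by auto
  define g where "g = (\<lambda>z. poly q z / z ^ N)"
  have g: "g holomorphic_on - {0}" unfolding g_def by (intro holomorphic_intros) auto
  have fg: "f z = (z - w) ^ s * g z" if "z \<in> - {0}" for z
    using fp[of z] that by (simp add: q(1) g_def field_simps)
  have rhs: "(\<lambda>z. (z - w) ^ s * g z) holomorphic_on - {0}"
    by (intro holomorphic_intros g)
  have "f holomorphic_on - {0}"
    using rhs by (rule holomorphic_transform) (use fg in simp)
  then have "(deriv ^^ s) f w = (deriv ^^ s) (\<lambda>z. (z - w) ^ s * g z) w"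
    using rhs w by (intro higher_deriv_transform_within_open[of _ "- {0}"] fg) auto
  also have "\<dots> = fact s * g w"
    using w by (intro higher_deriv_power_mult[OF g]) auto
  finally have "poly q w = 0" using zero[OF \<open>s < \<mu>\<close>] w by (simp add: g_def)
  then show False using q(2) by (simp add: poly_eq_0_iff_dvd)
qed

section \<open>Divisibility by products of linear factors with repetitions\<close>

lemma order_prod_linear:
  fixes x :: "nat \<Rightarrow> complex"
  shows "order (- y) (\<Prod>i<M. [:x i, 1:]) = card {i. i < M \<and> x i = y}"
proof (induction M)
  case (Suc M)
  have nz: "(\<Prod>i<M. [:x i, 1:]) * [:x M, 1:] \<noteq> 0"
    by (intro no_zero_divisors) auto
  have "order (- y) [:x M, 1:] = (if x M = y then 1 else 0)"
    using order_power_n_n[of "- y" 1] by (auto intro: order_0I simp: add_eq_0_iff)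
  moreover have "{i. i < Suc M \<and> x i = y} = {i. i < M \<and> x i = y} \<union> (if x M = y then {M} else {})"
    by (auto simp: less_Suc_eq)
  ultimately show ?case
    using Suc unfolding prod.lessThan_Suc order_mult[OF nz] by simp
qed simp

text \<open>The factors are split off one by one. Before step M the value x M has been used fewer
  times than it occurs in total, so the remaining quotient still has a root at -x M.\<close>

lemma prod_linear_dvd:
  fixes x :: "nat \<Rightarrow> complex"
  assumes "p \<noteq> 0" and dvd: "\<And>j. j < N \<Longrightarrow> [:x j, 1:] ^ card {i. i < N \<and> x i = x j} dvd p"
  shows "(\<Prod>j<N. [:x j, 1:]) dvd p"
proof -
  have "(\<Prod>j<M. [:x j, 1:]) dvd p" if "M \<le> N" for M
    using that
  proof (induction M)
    case (Suc M)
    then obtain r where r: "p = (\<Prod>j<M. [:x j, 1:]) * r" by (auto elim: dvdE)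
    have "card {i. i < M \<and> x i = x M} < card {i. i < N \<and> x i = x M}"
    proof (rule psubset_card_mono)
      have "{i. i < M \<and> x i = x M} \<subseteq> {i. i < N \<and> x i = x M}"
        using Suc.prems by (simp add: Collect_mono)
      moreover have "M \<in> {i. i < N \<and> x i = x M}" "M \<notin> {i. i < M \<and> x i = x M}"
        using Suc.prems by simp_all
      ultimately show "{i. i < M \<and> x i = x M} \<subset> {i. i < N \<and> x i = x M}" by blast
    qed simp
    also have "\<dots> \<le> order (- x M) p"
      using dvd[of M] Suc.prems \<open>p \<noteq> 0\<close> order_divides[of "- x M" _ p] by simp
    also have "\<dots> = card {i. i < M \<and> x i = x M} + order (- x M) r"
      using \<open>p \<noteq> 0\<close> unfolding r by (subst order_mult) (auto simp: order_prod_linear)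
    finally have "order (- x M) r \<noteq> 0" by simp
    then have "[:x M, 1:] dvd r" using order_1[of "- x M" r] dvd_power[of "order (- x M) r" "[:x M, 1:]"]
      by (auto intro: dvd_trans)
    then show ?case unfolding r prod.lessThan_Suc by (rule mult_dvd_mono[OF dvd_refl])
  qed simp
  then show ?thesis by blast
qed

text \<open>The symbol times z^(2n-1), which clears the negative powers. The 4n - 1 indices from
  -(2n-1) to 2n-1 give degree at most 4n - 2.\<close>

definition mask_poly :: "nat \<Rightarrow> (int \<Rightarrow> complex) \<Rightarrow> complex poly" where
  "mask_poly n c = (\<Sum>i<4 * n - 1. monom (c (int i - (2 * int n - 1))) i)"

lemma symbol_mask_poly:
  assumes n: "n \<ge> 1" and supp: "\<forall>j. \<bar>j\<bar> > 2 * int n - 1 \<longrightarrow> c j = 0" and z: "z \<noteq> 0"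
  shows "symbol c z * z ^ (2 * n - 1) = poly (mask_poly n c) z"
proof -
  let ?N = "2 * int n - 1"
  have "symbol c z = (\<Sum>j\<in>{-?N..?N}. c j * z powi j)"
    unfolding symbol_def using supp by (intro sum.mono_neutral_left) force+
  also have "\<dots> = (\<Sum>i<4 * n - 1. c (int i - ?N) * z powi (int i - ?N))"
    by (rule sum.reindex_bij_witness[where i = "\<lambda>i. int i - ?N" and j = "\<lambda>j. nat (j + ?N)"])
       (use n in auto)
  also have "\<dots> * z ^ (2 * n - 1) = (\<Sum>i<4 * n - 1. c (int i - ?N) * z ^ i)"
  proof -
    have "z powi (int i - ?N) * z ^ (2 * n - 1) = z ^ i" for i
    proof -
      have "z ^ (2 * n - 1) = z powi ?N"
        using n by (simp add: power_int_def nat_diff_distrib nat_mult_distrib)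
      then show ?thesis using z by (simp flip: power_int_add)
    qed
    then show ?thesis by (simp add: sum_distrib_right mult.assoc)
  qed
  finally show ?thesis by (simp add: mask_poly_def poly_sum poly_monom)
qed

text \<open>The prescribed roots use up 2n of at most 4n - 2 degrees. What is left for
  \<open>B\<close> is exactly the range in which \<open>cofactor_bound\<close> applies.\<close>

lemma interpolatory_mask_factorization:
  assumes n: "n \<ge> 1" and mask: "is_interpolatory_mask n lam k c"
  defines "A \<equiv> \<Prod>j<2 * n. [:of_real (exp (- (lam j / 2 ^ (k + 1)))), 1:]"
  obtains B where "mask_poly n c = A * B" "degree B < 2 * n"
    "A * B - reflect_arg (A * B) = monom 2 (2 * n - 1)"
proof -
  let ?p = "mask_poly n c"
  define x where "x j = complex_of_real (exp (- (lam j / 2 ^ (k + 1))))" for j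
  have sp: "symbol c z * z ^ (2 * n - 1) = poly ?p z" if "z \<noteq> 0" for z
    using mask that n by (intro symbol_mask_poly) (auto simp: is_interpolatory_mask_def)
  have refl: "?p - reflect_arg ?p = monom 2 (2 * n - 1)"
  proof (rule ccontr)
    assume "?p - reflect_arg ?p \<noteq> monom 2 (2 * n - 1)"
    \<comment> \<open>The symbol identity is known at nonzero points only, but a nonzero difference
      of polynomials would have finitely many roots.\<close>
    then have "finite {z. poly (?p - reflect_arg ?p - monom 2 (2 * n - 1)) z = 0}"
      by (intro poly_roots_finite) simp
    moreover have "- {0} \<subseteq> {z. poly (?p - reflect_arg ?p - monom 2 (2 * n - 1)) z = 0}"
    proof
      fix z :: complex assume "z \<in> - {0}"
      then have z: "z \<noteq> 0" by simp
      have "symbol c z + symbol c (- z) = 2" using mask z by (auto simp: is_interpolatory_mask_def)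
      moreover have "(- z) ^ (2 * n - 1) = - (z ^ (2 * n - 1))" using n by (intro power_minus_odd) simp
      ultimately have "poly ?p z - poly ?p (- z) = 2 * z ^ (2 * n - 1)"
        using sp[of z] sp[of "- z"] z by (metis diff_minus_eq_add distrib_right mult_minus_right neg_equal_0_iff_equal)
      then show "z \<in> {z. poly (?p - reflect_arg ?p - monom 2 (2 * n - 1)) z = 0}"
        by (simp add: poly_pcompose poly_monom)
    qed
    ultimately have "finite (- {0 :: complex})" using finite_subset by blast
    then show False using infinite_UNIV_char_0 by (metis Compl_eq_Diff_UNIV finite_Diff2 finite.emptyI finite_insert)
  qed
  then have nz: "?p \<noteq> 0" by auto
  have "A dvd ?p"
    unfolding A_def x_def[symmetric]
  proof (rule prod_linear_dvd[OF nz])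
    fix j assume j: "j < 2 * n"
    \<comment> \<open>Injectivity of the real exponential makes the multiplicities of the roots
      those of the values of \<open>lam\<close>.\<close>
    have "{i. i < 2 * n \<and> x i = x j} = {i. i < 2 * n \<and> lam i = lam j}"
      by (auto simp: x_def)
    then have card: "card {i. i < 2 * n \<and> x i = x j} = multiplicity_in (2 * n) lam j"
      by (simp add: multiplicity_in_def)
    have "x j \<noteq> 0" by (simp add: x_def)
    then have "[:- (- x j), 1:] ^ multiplicity_in (2 * n) lam j dvd ?p"
      using mask j by (intro dvd_of_higher_deriv_zero[OF sp]) (auto simp: is_interpolatory_mask_def x_def)
    then show "[:x j, 1:] ^ card {i. i < 2 * n \<and> x i = x j} dvd ?p"
      by (simp add: card)
  qed
  then obtain B where B: "?p = A * B" by (auto elim: dvdE)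
  have "degree A = 2 * n" unfolding A_def by (subst degree_prod_eq_sum_degree) auto
  moreover have "degree ?p \<le> 4 * n - 2"
    unfolding mask_poly_def by (intro degree_sum_le order_trans[OF degree_monom_le]) auto
  moreover have "degree ?p = degree A + degree B"
    using nz unfolding B by (intro degree_mult_eq) auto
  ultimately have "degree B < 2 * n" using n by linarith
  then show ?thesis using that[OF B] refl unfolding B by blast
qed

lemma coeff_norm_eq_0_iff [simp]: "coeff_norm p = 0 \<longleftrightarrow> p = 0"
  by (induction p) (auto simp: add_nonneg_eq_0_iff)

lemma abs_exp_minus_1_le: "\<bar>exp t - 1\<bar> \<le> \<bar>t\<bar> * exp \<bar>t\<bar>" for t :: real
proof (cases "t \<ge> 0")
  case True
  have "exp t * (1 - t) \<le> exp t * exp (- t)"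
    using exp_ge_add_one_self[of "- t"] by (intro mult_left_mono) auto
  then show ?thesis using True by (simp add: exp_minus algebra_simps)
next
  case False
  have "1 - exp t \<le> - t" using exp_ge_add_one_self[of t] by linarith
  also have "\<dots> \<le> \<bar>t\<bar> * exp \<bar>t\<bar>" using False by (simp add: mult_le_cancel_left1)
  finally show ?thesis using False by simp
qed

text \<open>The roots approach -1 like 2^-k, and \<open>cofactor_stability\<close> hands this rate
  on to the cofactors. The last clause is exact: for vanishing \<open>lam\<close> the linear part is
  (1 + z)^(2n) at every level, which identifies the limit cofactor as that of the Deslauriers-Dubuc
  scheme.\<close>

lemma interpolatory_scheme_factorization:
  assumes n: "n \<ge> 1" and scheme: "is_interpolatory_scheme n lam a"
  obtains B K where "K \<ge> 0" "\<And>k. coeff_norm (B k - dd_cofactor n) \<le> K * (1/2) ^ k"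
    "\<And>k z. z \<noteq> 0 \<Longrightarrow> symbol (a k) z * z ^ (2 * n - 1) =
       (\<Prod>j<2 * n. z + of_real (exp (- (lam j / 2 ^ (k + 1))))) * poly (B k) z"
    "(\<And>j. j < 2 * n \<Longrightarrow> lam j = 0) \<Longrightarrow> B = (\<lambda>_. dd_cofactor n)"
proof -
  define A where "A k = (\<Prod>j<2 * n. [:complex_of_real (exp (- (lam j / 2 ^ (k + 1)))), 1:])" for k
  have "\<exists>B. mask_poly n (a k) = A k * B \<and> degree B < 2 * n \<and>
      A k * B - reflect_arg (A k * B) = monom 2 (2 * n - 1)" for k
    using interpolatory_mask_factorization[OF n, of lam k "a k"] scheme
    unfolding is_interpolatory_scheme_def A_def by metis
  then obtain B where B: "\<And>k. mask_poly n (a k) = A k * B k" "\<And>k. degree (B k) < 2 * n"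
      "\<And>k. A k * B k - reflect_arg (A k * B k) = monom 2 (2 * n - 1)"
    by metis
  \<comment> \<open>One constant for all j: by |exp t - 1| <= |t| exp |t|, every root is within L
    2^-k of -1 at level k.\<close>
  define L where "L = (\<Sum>j<2 * n. \<bar>lam j\<bar> * exp \<bar>lam j\<bar>)"
  have L: "L \<ge> 0" unfolding L_def by (intro sum_nonneg) auto
  have close: "coeff_norm (A k - [:1, 1:] ^ (2 * n)) \<le> (real (2 * n) * (2 + L) ^ (2 * n) * L) * (1/2) ^ k" for k
  proof -
    have "coeff_norm (A k - [:1, 1:] ^ (2 * n)) \<le> real (2 * n) * (2 + L) ^ (2 * n) * (L * (1/2) ^ k)"
      unfolding A_def
    proof (rule coeff_norm_prod_linear_diff)
      \<comment> \<open>The cap \<open>M\<close> is taken to be \<open>L\<close>, which makes the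
        constant independent of the level.\<close>
      show "L * (1/2) ^ k \<le> L" using L by (simp add: mult_left_le power_le_one)
      fix j assume j: "j < 2 * n"
      let ?t = "- (lam j / 2 ^ (k + 1))"
      have t: "\<bar>?t\<bar> \<le> \<bar>lam j\<bar> * (1/2) ^ k" "\<bar>?t\<bar> \<le> \<bar>lam j\<bar>"
      proof -
        show "\<bar>?t\<bar> \<le> \<bar>lam j\<bar> * (1/2) ^ k" by (simp add: abs_divide field_simps)
        also have "\<dots> \<le> \<bar>lam j\<bar>" by (simp add: mult_left_le power_le_one)
        finally show "\<bar>?t\<bar> \<le> \<bar>lam j\<bar>" .
      qed
      have "cmod (of_real (exp ?t) - 1) = \<bar>exp ?t - 1\<bar>"
        by (metis norm_of_real of_real_1 of_real_diff)
      also have "\<dots> \<le> \<bar>?t\<bar> * exp \<bar>?t\<bar>" by (rule abs_exp_minus_1_le)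
      also have "\<dots> \<le> (\<bar>lam j\<bar> * (1/2) ^ k) * exp \<bar>lam j\<bar>"
        using t by (intro mult_mono) auto
      also have "\<dots> = \<bar>lam j\<bar> * exp \<bar>lam j\<bar> * (1/2) ^ k" by simp
      also have "\<dots> \<le> L * (1/2) ^ k"
        unfolding L_def using j
        by (intro mult_right_mono member_le_sum[of j "{..<2 * n}" "\<lambda>j. \<bar>lam j\<bar> * exp \<bar>lam j\<bar>"]) auto
      finally show "cmod (of_real (exp ?t) - 1) \<le> L * (1/2) ^ k" .
    qed (use L in simp)
    then show ?thesis by (simp add: mult_ac)
  qed
  note fe = dd_cofactor_functional_equation[OF n] and deg = degree_dd_cofactor[OF n]
  obtain K where K: "K \<ge> 0" "\<And>k. coeff_norm (B k - dd_cofactor n) \<le> K * (1/2) ^ k"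
    using cofactor_stability[OF B(3) fe B(2) deg close] by blast
  show ?thesis
  proof (rule that[OF K])
    fix k and z :: complex assume z: "z \<noteq> 0"
    have "symbol (a k) z * z ^ (2 * n - 1) = poly (A k * B k) z"
      using scheme n z B(1)[of k]
      by (subst symbol_mask_poly)
         (auto simp: is_interpolatory_scheme_def is_interpolatory_mask_def)
    then show "symbol (a k) z * z ^ (2 * n - 1) =
       (\<Prod>j<2 * n. z + of_real (exp (- (lam j / 2 ^ (k + 1))))) * poly (B k) z"
      by (simp add: A_def poly_prod add.commute)
  next
    assume "\<And>j. j < 2 * n \<Longrightarrow> lam j = 0"
    then have A: "A k = [:1, 1:] ^ (2 * n)" for k by (simp add: A_def)
    obtain K' where "\<And>D. degree D < 2 * n \<Longrightarrow>
       coeff_norm D \<le> K' * coeff_norm ([:1, 1:] ^ (2 * n) * D - reflect_arg ([:1, 1:] ^ (2 * n) * D))"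
      using cofactor_bound[of n] by blast
    note K' = this
    have "B k = dd_cofactor n" for k
    proof -
      let ?P = "[:1, 1:] ^ (2 * n) :: complex poly" and ?D = "B k - dd_cofactor n"
      \<comment> \<open>Uniqueness: both cofactors solve the same equation, so their difference has
        residual zero and therefore norm zero.\<close>
      have "?P * ?D - reflect_arg (?P * ?D)
        = (?P * B k - reflect_arg (?P * B k)) - (?P * dd_cofactor n - reflect_arg (?P * dd_cofactor n))"
        by (simp add: pcompose_diff pcompose_mult algebra_simps)
      also have "\<dots> = 0" using B(3)[of k] fe by (simp only: A) simp
      finally have "coeff_norm ?D \<le> 0"
        using K'[of ?D] degree_diff_less[OF B(2)[of k] deg] by simp
      then have "coeff_norm ?D = 0" using coeff_norm_nonneg[of ?D] by linarith
      then show ?thesis by simp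
    qed
    then show "B = (\<lambda>_. dd_cofactor n)" by blast
  qed
qed

section \<open>The Fourier transform of a basic limit function\<close>

lemma symbol_eq_sum:
  assumes "\<And>j. \<bar>j\<bar> > R \<Longrightarrow> c j = 0"
  shows "symbol c z = (\<Sum>j\<in>{-R..R}. c j * z powi j)"
  unfolding symbol_def
proof (rule sum.mono_neutral_left)
  show "{j. c j \<noteq> 0} \<subseteq> {-R..R}"
  proof
    fix j assume "j \<in> {j. c j \<noteq> 0}"
    then have "\<not> \<bar>j\<bar> > R" using assms by auto
    then show "j \<in> {-R..R}" by auto
  qed
qed auto

lemma subdivide_eq_sum:
  assumes c: "\<And>j. \<bar>j\<bar> > R \<Longrightarrow> c j = 0" and g: "\<And>j. \<bar>j\<bar> > G \<Longrightarrow> g j = 0"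
  shows "subdivide c g j = (\<Sum>l\<in>{-G..G}. c (j - 2 * l) * g l)"
  unfolding subdivide_def
proof (rule sum.mono_neutral_cong)
  have "{l. c (j - 2 * l) \<noteq> 0} \<subseteq> {- (\<bar>j\<bar> + R)..\<bar>j\<bar> + R}"
  proof
    fix l assume "l \<in> {l. c (j - 2 * l) \<noteq> 0}"
    then have "\<not> \<bar>j - 2 * l\<bar> > R" using c by auto
    then show "l \<in> {- (\<bar>j\<bar> + R)..\<bar>j\<bar> + R}" by auto
  qed
  then show "finite {l. c (j - 2 * l) \<noteq> 0}" using finite_subset by blast
  show "c (j - 2 * l) * g l = 0" if "l \<in> {l. c (j - 2 * l) \<noteq> 0} - {-G..G}" for l
    using that g[of l] by force
qed auto

text \<open>Subdivision inserts zeros between the data, which replaces z by z^2 in their symbol, and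
  then convolves with the mask.\<close>

lemma symbol_subdivide:
  assumes c: "\<And>j. \<bar>j\<bar> > R \<Longrightarrow> c j = 0" and g: "\<And>j. \<bar>j\<bar> > G \<Longrightarrow> g j = 0" and z: "z \<noteq> 0"
    and sub: "\<And>j. \<bar>j\<bar> > R + 2 * G \<Longrightarrow> subdivide c g j = 0"
  shows "symbol (subdivide c g) z = symbol c z * symbol g (z ^ 2)"
proof -
  let ?T = "R + 2 * G"
  have "symbol (subdivide c g) z = (\<Sum>j\<in>{-?T..?T}. subdivide c g j * z powi j)"
    by (rule symbol_eq_sum[OF sub])
  also have "\<dots> = (\<Sum>j\<in>{-?T..?T}. \<Sum>l\<in>{-G..G}. c (j - 2 * l) * g l * z powi j)"
    by (simp add: subdivide_eq_sum[OF c g] sum_distrib_right)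
  also have "\<dots> = (\<Sum>l\<in>{-G..G}. \<Sum>j\<in>{-?T..?T}. c (j - 2 * l) * g l * z powi j)"
    by (rule sum.swap)
  also have "\<dots> = (\<Sum>l\<in>{-G..G}. symbol c z * (g l * (z ^ 2) powi l))"
  proof (rule sum.cong[OF refl])
    fix l assume l: "l \<in> {-G..G}"
    \<comment> \<open>For |l| <= G the window of radius R around 2l lies inside the full range, and
      the mask vanishes outside the window.\<close>
    have "(\<Sum>j\<in>{-?T..?T}. c (j - 2 * l) * g l * z powi j) =
       (\<Sum>j\<in>{2 * l - R..2 * l + R}. c (j - 2 * l) * g l * z powi j)"
    proof (rule sum.mono_neutral_right)
      show "\<forall>j\<in>{-?T..?T} - {2 * l - R..2 * l + R}. c (j - 2 * l) * g l * z powi j = 0"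
      proof
        fix j assume "j \<in> {-?T..?T} - {2 * l - R..2 * l + R}"
        then have "\<bar>j - 2 * l\<bar> > R" by auto
        then show "c (j - 2 * l) * g l * z powi j = 0" using c by simp
      qed
    qed (use l in auto)
    also have "\<dots> = (\<Sum>i\<in>{-R..R}. c i * g l * z powi (i + 2 * l))"
      by (rule sum.reindex_bij_witness[where i = "\<lambda>i. i + 2 * l" and j = "\<lambda>j. j - 2 * l"]) auto
    also have "\<dots> = (\<Sum>i\<in>{-R..R}. c i * z powi i) * (g l * (z ^ 2) powi l)"
    proof -
      have pow: "z powi (i + 2 * l) = z powi i * (z ^ 2) powi l" for i
      proof -
        have "(z ^ 2) powi l = z powi (2 * l)"
          by (metis power_int_mult power_int_numeral)
        then show ?thesis using z by (simp add: power_int_add)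
      qed
      show ?thesis unfolding pow sum_distrib_right by (simp add: mult_ac)
    qed
    finally show "(\<Sum>j\<in>{-?T..?T}. c (j - 2 * l) * g l * z powi j) = symbol c z * (g l * (z ^ 2) powi l)"
      by (simp add: symbol_eq_sum[OF c])
  qed
  also have "\<dots> = symbol c z * symbol g (z ^ 2)"
    by (simp add: symbol_eq_sum[OF g] sum_distrib_left)
  finally show ?thesis .
qed

abbreviation kronecker :: "int \<Rightarrow> complex" where
  "kronecker \<equiv> (\<lambda>j. if j = 0 then 1 else 0)"

text \<open>The radii obey G' = R + 2 G with G = 0 at level 0. After scaling by 2^-N the support
  stays inside [-R, R].\<close>

lemma scheme_data_support:
  assumes a: "\<And>k j. \<bar>j\<bar> > R \<Longrightarrow> a k j = 0" and j: "\<bar>j\<bar> > R * (2 ^ N - 1)"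
  shows "scheme_data a kronecker N j = 0"
  using j
proof (induction N arbitrary: j)
  case (Suc N)
  have "scheme_data a kronecker (Suc N) j =
     (\<Sum>l\<in>{- (R * (2 ^ N - 1))..R * (2 ^ N - 1)}. a N (j - 2 * l) * scheme_data a kronecker N l)"
    unfolding scheme_data.simps by (rule subdivide_eq_sum[OF a Suc.IH])
  also have "\<dots> = 0"
  proof (intro sum.neutral ballI)
    fix l assume "l \<in> {- (R * (2 ^ N - 1))..R * (2 ^ N - 1)}"
    moreover have "R * (2 ^ Suc N - 1) = R + 2 * (R * (2 ^ N - 1))" by (simp add: algebra_simps)
    ultimately have "\<bar>j - 2 * l\<bar> > R" using Suc.prems by auto
    then show "a N (j - 2 * l) * scheme_data a kronecker N l = 0" using a by simp
  qed
  finally show ?case .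
qed auto

lemma symbol_scheme_data:
  assumes a: "\<And>k j. \<bar>j\<bar> > R \<Longrightarrow> a k j = 0"
  shows "symbol (scheme_data a kronecker N) (exp (- (\<i> * of_real (\<omega> / 2 ^ N)))) =
    (\<Prod>k<N. symbol (a k) (exp (- (\<i> * of_real (\<omega> / 2 ^ (k + 1))))))"
proof (induction N)
  case 0
  show ?case by (simp add: symbol_def)
next
  case (Suc N)
  let ?z = "exp (- (\<i> * of_real (\<omega> / 2 ^ Suc N)))"
  have "?z ^ 2 = exp (- (\<i> * of_real (\<omega> / 2 ^ N)))"
    by (simp add: exp_double[symmetric])
  moreover have "symbol (scheme_data a kronecker (Suc N)) ?z =
      symbol (a N) ?z * symbol (scheme_data a kronecker N) (?z ^ 2)"
    unfolding scheme_data.simps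
  proof (rule symbol_subdivide[OF a scheme_data_support[OF a]])
    fix j assume "\<bar>j\<bar> > R + 2 * (R * (2 ^ N - 1))"
    then have "scheme_data a kronecker (Suc N) j = 0"
      by (intro scheme_data_support[OF a]) (auto simp: algebra_simps)
    then show "subdivide (a N) (scheme_data a kronecker N) j = 0" by simp
  qed auto
  ultimately show ?case using Suc by simp
qed

text \<open>Both the data and the exponential are frozen at the left dyadic node, so the integral
  equals a value of the symbol divided by 2^N with no error term.\<close>

definition step_function :: "(int \<Rightarrow> complex) \<Rightarrow> nat \<Rightarrow> real \<Rightarrow> real \<Rightarrow> complex" where
  "step_function g N \<omega> x =
     g \<lfloor>2 ^ N * x\<rfloor> * exp (- (\<i> * of_real (of_int \<lfloor>2 ^ N * x\<rfloor> / 2 ^ N) * of_real \<omega>))"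

lemma integral_step_function:
  assumes g: "\<And>j. \<bar>j\<bar> > T \<Longrightarrow> g j = 0"
  shows "integrable lborel (step_function g N \<omega>)"
    and "(LINT x|lborel. step_function g N \<omega> x) = symbol g (exp (- (\<i> * of_real (\<omega> / 2 ^ N)))) / 2 ^ N"
proof -
  let ?z = "exp (- (\<i> * of_real (\<omega> / 2 ^ N)))"
  let ?I = "\<lambda>j. {of_int j / 2 ^ N ..< (of_int j + 1) / 2 ^ N} :: real set"
  have mem: "x \<in> ?I j \<longleftrightarrow> \<lfloor>2 ^ N * x\<rfloor> = j" for x j
    by (auto simp: floor_eq_iff field_simps)
  have eq: "step_function g N \<omega> x = (\<Sum>j\<in>{-T..T}. indicat_real (?I j) x *\<^sub>R (g j * ?z powi j))" for x
  proof -
    let ?j = "\<lfloor>2 ^ N * x\<rfloor>"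
    have pow: "?z powi ?j = exp (- (\<i> * of_real (of_int ?j / 2 ^ N) * of_real \<omega>))"
      by (subst exp_power_int) (simp add: algebra_simps)
    have "(\<Sum>j\<in>{-T..T}. indicat_real (?I j) x *\<^sub>R (g j * ?z powi j)) =
        (\<Sum>j\<in>{-T..T}. if ?j = j then g j * ?z powi j else 0)"
      by (intro sum.cong) (simp_all add: indicator_def mem del: atLeastLessThan_iff)
    also have "\<dots> = (if ?j \<in> {-T..T} then g ?j * ?z powi ?j else 0)"
      by (simp add: sum.delta')
    also have "\<dots> = g ?j * ?z powi ?j" using g[of ?j] by force
    finally show ?thesis unfolding step_function_def pow by (rule sym)
  qed
  have fin: "emeasure lborel (?I j) < \<infinity>" for j
    by (subst emeasure_lborel_Ico) (auto simp: divide_right_mono)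
  have int: "integrable lborel (\<lambda>x. indicat_real (?I j) x *\<^sub>R (g j * ?z powi j))" for j
    using fin by (intro integrable_scaleR_left integrable_real_indicator) auto
  show "integrable lborel (step_function g N \<omega>)"
    unfolding eq by (intro Bochner_Integration.integrable_sum int)
  have "(LINT x|lborel. indicat_real (?I j) x *\<^sub>R (g j * ?z powi j)) = (1 / 2 ^ N) *\<^sub>R (g j * ?z powi j)" for j
  proof -
    have "(LINT x|lborel. indicat_real (?I j) x *\<^sub>R (g j * ?z powi j)) =
        measure lborel (?I j) *\<^sub>R (g j * ?z powi j)"
      using fin[of j] by (subst integral_scaleR_left) (auto intro!: integrable_real_indicator)
    also have "measure lborel (?I j) = 1 / 2 ^ N"
      by (subst measure_lborel_Ico) (auto simp: divide_right_mono diff_divide_distrib[symmetric])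
    finally show ?thesis .
  qed
  then have "(LINT x|lborel. step_function g N \<omega> x) = (\<Sum>j\<in>{-T..T}. (1 / 2 ^ N) *\<^sub>R (g j * ?z powi j))"
    unfolding eq Bochner_Integration.integral_sum[OF int] by (rule sum.cong[OF refl])
  also have "\<dots> = symbol g ?z / 2 ^ N"
    by (simp add: symbol_eq_sum[OF g] scaleR_conv_of_real sum_divide_distrib)
  finally show "(LINT x|lborel. step_function g N \<omega> x) = symbol g ?z / 2 ^ N" .
qed

section \<open>From the discrete data to the limit function\<close>

lemma floor_dyadic_tendsto: "(\<lambda>N. of_int \<lfloor>2 ^ N * x\<rfloor> / 2 ^ N :: real) \<longlonglongrightarrow> x"
proof (rule tendsto_sandwich)
  show "\<forall>\<^sub>F N in sequentially. x - (1/2) ^ N \<le> of_int \<lfloor>2 ^ N * x\<rfloor> / 2 ^ N"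
  proof (intro always_eventually allI)
    fix N
    have "2 ^ N * x - 1 \<le> of_int \<lfloor>2 ^ N * x\<rfloor>" by linarith
    then show "x - (1/2) ^ N \<le> of_int \<lfloor>2 ^ N * x\<rfloor> / 2 ^ N" by (simp add: field_simps)
  qed
  show "\<forall>\<^sub>F N in sequentially. of_int \<lfloor>2 ^ N * x\<rfloor> / 2 ^ N \<le> x"
  proof (intro always_eventually allI)
    fix N
    have "of_int \<lfloor>2 ^ N * x\<rfloor> \<le> 2 ^ N * x" by linarith
    then show "of_int \<lfloor>2 ^ N * x\<rfloor> / 2 ^ N \<le> x" by (simp add: field_simps)
  qed
  have "(\<lambda>N. x - (1/2) ^ N) \<longlonglongrightarrow> x - 0"
    by (intro tendsto_intros LIMSEQ_realpow_zero) auto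
  then show "(\<lambda>N. x - (1/2) ^ N) \<longlonglongrightarrow> x" by simp
qed simp

text \<open>Dominated convergence for the step functions: uniform closeness at dyadic points and
  continuity of F give the pointwise limit, and the common support [-R, R] with a uniform bound on
  the data gives the majorant.\<close>

lemma basic_limit_function_fourier:
  assumes a: "\<And>k j. \<bar>j\<bar> > R \<Longrightarrow> a k j = 0" and R: "R \<ge> 1" and lim: "is_basic_limit_function a F"
  shows "continuous_on UNIV F" and "\<And>x. \<bar>x\<bar> > of_int R \<Longrightarrow> F x = 0"
    and "(\<lambda>N. \<Prod>k<N. symbol (a k) (exp (- (\<i> * of_real (\<omega> / 2 ^ (k + 1))))) / 2) \<longlonglongrightarrow> fourier F \<omega>"
proof -
  let ?f = "scheme_data a kronecker"
  show cont: "continuous_on UNIV F"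
    using lim by (auto simp: is_basic_limit_function_def is_limit_function_def)
  have sup: "(\<lambda>N. SUP j. ennreal (cmod (F (of_int j / 2 ^ N) - ?f N j))) \<longlonglongrightarrow> 0"
    using lim by (auto simp: is_basic_limit_function_def is_limit_function_def)
  have unif: "\<forall>\<^sub>F N in sequentially. \<forall>j. cmod (F (of_int j / 2 ^ N) - ?f N j) < e" if "e > 0" for e
  proof -
    have "\<forall>\<^sub>F N in sequentially. (SUP j. ennreal (cmod (F (of_int j / 2 ^ N) - ?f N j))) < ennreal e"
      using sup that by (intro order_tendstoD(2)) auto
    then show ?thesis
    proof eventually_elim
      case (elim N)
      have "ennreal (cmod (F (of_int j / 2 ^ N) - ?f N j)) < ennreal e" for j
        using elim SUP_upper[of j UNIV "\<lambda>j. ennreal (cmod (F (of_int j / 2 ^ N) - ?f N j))"] by (simp add: le_less_trans)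
      then show ?case using that by (simp add: ennreal_less_iff)
    qed
  qed
  have pw: "(\<lambda>N. ?f N \<lfloor>2 ^ N * x\<rfloor>) \<longlonglongrightarrow> F x" for x
  proof -
    have "(\<lambda>N. F (of_int \<lfloor>2 ^ N * x\<rfloor> / 2 ^ N) - ?f N \<lfloor>2 ^ N * x\<rfloor>) \<longlonglongrightarrow> 0"
    proof (rule tendstoI)
      fix e :: real assume "e > 0"
      from unif[OF this]
      show "\<forall>\<^sub>F N in sequentially. dist (F (of_int \<lfloor>2 ^ N * x\<rfloor> / 2 ^ N) - ?f N \<lfloor>2 ^ N * x\<rfloor>) 0 < e"
        by eventually_elim simp
    qed
    moreover have "(\<lambda>N. F (of_int \<lfloor>2 ^ N * x\<rfloor> / 2 ^ N)) \<longlonglongrightarrow> F x"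
      using cont floor_dyadic_tendsto[of x]
      by (intro continuous_on_tendsto_compose[where s = UNIV and f = F]) auto
    ultimately have "(\<lambda>N. F (of_int \<lfloor>2 ^ N * x\<rfloor> / 2 ^ N) - (F (of_int \<lfloor>2 ^ N * x\<rfloor> / 2 ^ N) - ?f N \<lfloor>2 ^ N * x\<rfloor>))
       \<longlonglongrightarrow> F x - 0" by (intro tendsto_diff)
    then show ?thesis by simp
  qed
  have zero: "?f N \<lfloor>2 ^ N * x\<rfloor> = 0" if x: "\<bar>x\<bar> > of_int R" for x :: real and N
  proof (rule scheme_data_support[OF a])
    \<comment> \<open>Taking the floor may cost up to 1, but both sides are integers: its modulus is
      at least 2^N R, which exceeds R (2^N - 1) because R >= 1.\<close>
    have "2 ^ N * of_int R < 2 ^ N * \<bar>x\<bar>" using x by simp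
    also have "\<dots> = \<bar>2 ^ N * x\<bar>" by (simp add: abs_mult)
    also have "\<dots> < \<bar>of_int \<lfloor>2 ^ N * x\<rfloor>\<bar> + 1" by linarith
    finally have "of_int (2 ^ N * R) < (of_int (\<bar>\<lfloor>2 ^ N * x\<rfloor>\<bar> + 1) :: real)" by simp
    then have "2 ^ N * R < \<bar>\<lfloor>2 ^ N * x\<rfloor>\<bar> + 1" by (simp only: of_int_less_iff)
    then show "R * (2 ^ N - 1) < \<bar>\<lfloor>2 ^ N * x\<rfloor>\<bar>" using R by (simp add: algebra_simps)
  qed
  show supp: "F x = 0" if x: "\<bar>x\<bar> > of_int R" for x
    using pw[of x] zero[OF x] by (simp add: LIMSEQ_const_iff)
  have "compact (F ` {- of_int R..of_int R})"
    using cont by (intro compact_continuous_image) (auto intro: continuous_on_subset)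
  then obtain M where M: "\<And>x. x \<in> {- of_int R..of_int R} \<Longrightarrow> cmod (F x) \<le> M"
    by (meson bounded_iff compact_imp_bounded imageI)
  have M0: "M \<ge> 0" using M[of 0] R by (smt (verit) atLeastAtMost_iff norm_ge_zero of_int_0_le_iff)
  have M: "cmod (F x) \<le> M" for x
    using M[of x] supp[of x] M0 by (cases "\<bar>x\<bar> > of_int R") (auto simp: not_less abs_le_iff)
  \<comment> \<open>The data are bounded by M + 1 only from level N0 on, so the sequence of
    integrals starts there; the offset is removed at the end.\<close>
  obtain N0 where N0: "\<And>N j. N \<ge> N0 \<Longrightarrow> cmod (F (of_int j / 2 ^ N) - ?f N j) < 1"
    using unif[of 1] by (auto simp: eventually_sequentially)
  have fb: "cmod (?f N j) \<le> M + 1" if "N \<ge> N0" for N j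
    using N0[OF that, of j] M[of "of_int j / 2 ^ N"]
      norm_triangle_ineq2[of "?f N j" "F (of_int j / 2 ^ N)"] by (simp add: norm_minus_commute)
  define s where "s N = step_function (?f (N + N0)) (N + N0) \<omega>" for N
  have supp_data: "?f N j = 0" if "\<bar>j\<bar> > R * (2 ^ N - 1)" for N j
    using scheme_data_support[OF a that] .
  have "(\<lambda>N. LINT x|lborel. s N x) \<longlonglongrightarrow> (LINT x|lborel. F x * exp (- (\<i> * of_real x * of_real \<omega>)))"
  proof (rule integral_dominated_convergence[where w = "\<lambda>x. (M + 1) * indicator {- of_int R..of_int R} x"])
    show "(\<lambda>x. F x * exp (- (\<i> * of_real x * of_real \<omega>))) \<in> borel_measurable lborel"
      using cont by (auto intro!: borel_measurable_continuous_onI continuous_intros)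
    show "s N \<in> borel_measurable lborel" for N
      unfolding s_def 
      by (rule borel_measurable_integrable[OF integral_step_function(1)[OF supp_data]])
    show "integrable lborel (\<lambda>x. (M + 1) * indicator {- real_of_int R..of_int R} x)"
      by (intro integrable_mult_right integrable_real_indicator) (auto simp: emeasure_lborel_Icc_eq)
    show "AE x in lborel. (\<lambda>N. s N x) \<longlonglongrightarrow> F x * exp (- (\<i> * of_real x * of_real \<omega>))"
    proof (intro AE_I2)
      fix x
      have "(\<lambda>N. step_function (?f N) N \<omega> x) \<longlonglongrightarrow> F x * exp (- (\<i> * of_real x * of_real \<omega>))"
        unfolding step_function_def
        by (intro tendsto_intros pw floor_dyadic_tendsto)
      then show "(\<lambda>N. s N x) \<longlonglongrightarrow> F x * exp (- (\<i> * of_real x * of_real \<omega>))"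
        unfolding s_def by (rule LIMSEQ_ignore_initial_segment)
    qed
    show "AE x in lborel. cmod (s N x) \<le> (M + 1) * indicator {- of_int R..of_int R} x" for N
    proof (intro AE_I2)
      fix x
      have norm: "cmod (s N x) = cmod (?f (N + N0) \<lfloor>2 ^ (N + N0) * x\<rfloor>)"
        by (simp add: s_def step_function_def norm_mult)
      show "cmod (s N x) \<le> (M + 1) * indicator {- of_int R..of_int R} x"
      proof (cases "\<bar>x\<bar> > of_int R")
        case True
        then show ?thesis using M0 unfolding norm zero[OF True] by simp
      next
        case False
        then have "x \<in> {- of_int R..of_int R}" by (auto simp: not_less abs_le_iff)
        then show ?thesis unfolding norm using fb[of "N + N0"] by simp
      qed
    qed
  qed
  moreover have "(LINT x|lborel. s N x) =
     (\<Prod>k<N + N0. symbol (a k) (exp (- (\<i> * of_real (\<omega> / 2 ^ (k + 1))))) / 2)" for N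
  proof -
    have "(LINT x|lborel. s N x) =
       symbol (?f (N + N0)) (exp (- (\<i> * of_real (\<omega> / 2 ^ (N + N0))))) / 2 ^ (N + N0)"
      unfolding s_def by (rule integral_step_function(2)) (rule supp_data)
    also have "symbol (?f (N + N0)) (exp (- (\<i> * of_real (\<omega> / 2 ^ (N + N0))))) =
       (\<Prod>k<N + N0. symbol (a k) (exp (- (\<i> * of_real (\<omega> / 2 ^ (k + 1))))))"
      by (rule symbol_scheme_data) (rule a)
    finally show ?thesis by (simp add: prod_dividef)
  qed
  ultimately have "(\<lambda>N. \<Prod>k<N + N0. symbol (a k) (exp (- (\<i> * of_real (\<omega> / 2 ^ (k + 1))))) / 2) \<longlonglongrightarrow> fourier F \<omega>"
    by (simp add: fourier_def)
  then show "(\<lambda>N. \<Prod>k<N. symbol (a k) (exp (- (\<i> * of_real (\<omega> / 2 ^ (k + 1))))) / 2) \<longlonglongrightarrow> fourier F \<omega>"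
    by (rule LIMSEQ_offset)
qed

section \<open>Fourier inversion and smoothness\<close>

text \<open>After the substitution \<open>\<omega>\<close> = s t this is the characteristic function
  of the standard normal distribution.\<close>

lemma gaussian_fourier_integral:
  fixes s u :: real
  assumes s: "s > 0"
  shows "integrable lborel (\<lambda>\<omega>. exp (- (\<omega> / s)\<^sup>2 / 2))"
    and "(CLINT \<omega>|lborel. iexp (u * \<omega>) * of_real (exp (- (\<omega> / s)\<^sup>2 / 2)))
      = of_real (2 * pi * s * std_normal_density (s * u))"
proof -
  have dens: "exp (- t\<^sup>2 / 2) = sqrt (2 * pi) * std_normal_density t" for t :: real
    by (simp add: std_normal_density_def)
  have "integrable lborel (\<lambda>t. sqrt (2 * pi) * std_normal_density t)"
    by (intro integrable_mult_right integrable_normal_density) simp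
  then have "integrable lborel (\<lambda>t :: real. exp (- t\<^sup>2 / 2))" by (simp only: dens)
  from lborel_integrable_real_affine[OF this, of "1 / s" 0] s
  show "integrable lborel (\<lambda>\<omega>. exp (- (\<omega> / s)\<^sup>2 / 2))" by simp
  have char: "(CLINT t|lborel. of_real (std_normal_density t) * iexp (u * s * t)) =
      of_real (exp (- (s * u)\<^sup>2 / 2))"
  proof -
    have "(CLINT t|lborel. of_real (std_normal_density t) * iexp (u * s * t))
        = char std_normal_distribution (u * s)"
      unfolding char_def by (subst integral_density) (auto simp: scaleR_conv_of_real mult.assoc)
    then show ?thesis by (simp add: char_std_normal_distribution mult.commute)
  qed
  have "(CLINT \<omega>|lborel. iexp (u * \<omega>) * of_real (exp (- (\<omega> / s)\<^sup>2 / 2))) =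
     s *\<^sub>R (CLINT t|lborel. iexp (u * (0 + s * t)) * of_real (exp (- ((0 + s * t) / s)\<^sup>2 / 2)))"
    using s by (subst lborel_integral_real_affine[where c = s and t = 0]) auto
  also have "(\<lambda>t. iexp (u * (0 + s * t)) * of_real (exp (- ((0 + s * t) / s)\<^sup>2 / 2))) =
     (\<lambda>t. of_real (sqrt (2 * pi)) * (of_real (std_normal_density t) * iexp (u * s * t)))"
  proof (rule ext)
    fix t
    have "(0 + s * t) / s = t" using s by simp
    then show "iexp (u * (0 + s * t)) * of_real (exp (- ((0 + s * t) / s)\<^sup>2 / 2)) =
        of_real (sqrt (2 * pi)) * (of_real (std_normal_density t) * iexp (u * s * t))"
      by (simp only: dens of_real_mult add_0 mult_ac)
  qed
  also have "(CLINT t|lborel. of_real (sqrt (2 * pi)) * (of_real (std_normal_density t) * iexp (u * s * t)))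
     = of_real (sqrt (2 * pi) * exp (- (s * u)\<^sup>2 / 2))"
    unfolding integral_mult_right_zero char by simp
  also have "s *\<^sub>R complex_of_real (sqrt (2 * pi) * exp (- (s * u)\<^sup>2 / 2)) =
     of_real (2 * pi * s * std_normal_density (s * u))"
    unfolding dens by (simp add: scaleR_conv_of_real real_sqrt_mult mult_ac flip: of_real_mult)
  finally show "(CLINT \<omega>|lborel. iexp (u * \<omega>) * of_real (exp (- (\<omega> / s)\<^sup>2 / 2)))
      = of_real (2 * pi * s * std_normal_density (s * u))" .
qed

lemma fourier_eq_iexp: "fourier F \<omega> = (CLINT x|lborel. F x * iexp (- (x * \<omega>)))"
  unfolding fourier_def by (simp add: mult.assoc)

lemma fourier_measurable [measurable]:
  assumes [measurable]: "F \<in> borel_measurable borel"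
  shows "fourier F \<in> borel_measurable borel"
  unfolding fourier_eq_iexp[abs_def] by measurable

text \<open>No integrability is required: a non-integrable integrand makes the left-hand side 0 by
  default.\<close>

lemma norm_fourier_le: "cmod (fourier F \<omega>) \<le> (LINT x|lborel. cmod (F x))"
proof -
  have "cmod (fourier F \<omega>) \<le> (LINT x|lborel. cmod (F x * iexp (- (x * \<omega>))))"
    unfolding fourier_eq_iexp by (rule integral_norm_bound)
  then show ?thesis by (simp add: norm_mult)
qed

text \<open>The Gaussian damping makes the double integral absolutely convergent. After Fubini the
  inner integral is again a Gaussian, so the right-hand side is an average of F concentrated near x
  for large s.\<close>

lemma fourier_inversion_gaussian:
  fixes F :: "real \<Rightarrow> complex" and s :: real
  assumes F: "integrable lborel F" and s: "s > 0"
  shows "(CLINT \<omega>|lborel. fourier F \<omega> * iexp (x * \<omega>) * of_real (exp (- (\<omega> / s)\<^sup>2 / 2))) =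
     2 * of_real pi * (CLINT t|lborel. of_real (std_normal_density t) * F (x - t / s))"
proof -
  have Fm [measurable]: "F \<in> borel_measurable borel" using F by simp
  define E where "E \<omega> = exp (- (\<omega> / s)\<^sup>2 / 2)" for \<omega> :: real
  have Em [measurable]: "E \<in> borel_measurable borel" unfolding E_def by measurable
  have E: "integrable lborel E" unfolding E_def using gaussian_fourier_integral(1)[OF s] .
  define f where "f y \<omega> = F y * iexp (- (y * \<omega>)) * iexp (x * \<omega>) * of_real (E \<omega>)" for y \<omega>
  have nf: "cmod (f y \<omega>) = cmod (F y) * E \<omega>" for y \<omega>
    by (simp add: f_def norm_mult E_def)
  have int: "integrable (lborel \<Otimes>\<^sub>M lborel) (case_prod f)"
  proof (rule lborel_pair.Fubini_integrable)
    show "case_prod f \<in> borel_measurable (lborel \<Otimes>\<^sub>M lborel)"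
      unfolding f_def by measurable
    show "integrable lborel (\<lambda>y. LINT \<omega>|lborel. cmod (case_prod f (y, \<omega>)))"
      using F by (simp add: nf)
    show "AE y in lborel. integrable lborel (\<lambda>\<omega>. case_prod f (y, \<omega>))"
    proof (intro AE_I2)
      fix y
      have "integrable lborel (\<lambda>\<omega>. cmod (F y) * E \<omega>)" using E by simp
      then show "integrable lborel (\<lambda>\<omega>. case_prod f (y, \<omega>))"
        by (rule Bochner_Integration.integrable_bound) (auto simp: f_def nf[symmetric])
    qed
  qed
  have "(CLINT \<omega>|lborel. fourier F \<omega> * iexp (x * \<omega>) * of_real (E \<omega>)) =
      (CLINT \<omega>|lborel. CLINT y|lborel. f y \<omega>)"
    unfolding fourier_eq_iexp f_def by (simp only: integral_mult_left_zero)
  also have "\<dots> = (CLINT y|lborel. CLINT \<omega>|lborel. f y \<omega>)"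
    by (rule lborel_pair.Fubini_integral[OF int])
  also have "\<dots> = (CLINT y|lborel. F y * of_real (2 * pi * s * std_normal_density (s * (x - y))))"
  proof (rule Bochner_Integration.integral_cong[OF refl])
    fix y
    have "f y = (\<lambda>\<omega>. F y * (iexp ((x - y) * \<omega>) * of_real (E \<omega>)))"
      by (auto simp: f_def algebra_simps simp flip: exp_add)
    then have "(CLINT \<omega>|lborel. f y \<omega>) = F y * (CLINT \<omega>|lborel. iexp ((x - y) * \<omega>) * of_real (E \<omega>))"
      by simp
    then show "(CLINT \<omega>|lborel. f y \<omega>) = F y * of_real (2 * pi * s * std_normal_density (s * (x - y)))"
      unfolding E_def gaussian_fourier_integral(2)[OF s] .
  qed
  \<comment> \<open>The substitution y = x - t / s moves the scale from the density into the
    argument of F, so that one majorant serves all s.\<close>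
  also have "\<dots> = (1 / s) *\<^sub>R (CLINT t|lborel. F (x + - (1 / s) * t) *
      of_real (2 * pi * s * std_normal_density (s * (x - (x + - (1 / s) * t)))))"
    using s by (subst lborel_integral_real_affine[where c = "- (1 / s)" and t = x]) auto
  also have "(\<lambda>t. F (x + - (1 / s) * t) *
      of_real (2 * pi * s * std_normal_density (s * (x - (x + - (1 / s) * t))))) =
      (\<lambda>t. (2 * of_real pi * of_real s) * (of_real (std_normal_density t) * F (x - t / s)))"
    using s by (auto simp: mult_ac)
  also have "(1 / s) *\<^sub>R (CLINT t|lborel. (2 * of_real pi * of_real s) * (of_real (std_normal_density t) * F (x - t / s)))
     = 2 * of_real pi * (CLINT t|lborel. of_real (std_normal_density t) * F (x - t / s))"
    using s by (simp add: scaleR_conv_of_real field_simps)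
  finally show ?thesis unfolding E_def .
qed

text \<open>Let s tend to infinity in the damped formula: the left integrals are dominated by the
  modulus of the transform, the right ones by M times the normal density.\<close>

lemma fourier_inversion:
  fixes F :: "real \<Rightarrow> complex"
  assumes cont: "continuous_on UNIV F" and bdd: "\<And>x. cmod (F x) \<le> M"
    and F: "integrable lborel F" and FF: "integrable lborel (fourier F)"
  shows "F x = (CLINT \<omega>|lborel. fourier F \<omega> * iexp (x * \<omega>)) / (2 * of_real pi)"
proof -
  have Fm [measurable]: "F \<in> borel_measurable borel" using F by simp
  define s where "s k = real (Suc k)" for k
  have s: "s k > 0" for k by (simp add: s_def)
  have inv: "(\<lambda>k. c / s k) \<longlonglongrightarrow> 0" for c :: real
    unfolding s_def by (rule LIMSEQ_Suc[OF lim_const_over_n])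
  let ?I = "\<lambda>k. CLINT \<omega>|lborel. fourier F \<omega> * iexp (x * \<omega>) * of_real (exp (- (\<omega> / s k)\<^sup>2 / 2))"
  have "?I \<longlonglongrightarrow> (CLINT \<omega>|lborel. fourier F \<omega> * iexp (x * \<omega>))"
  proof (rule integral_dominated_convergence[where w = "\<lambda>\<omega>. cmod (fourier F \<omega>)"])
    show "AE \<omega> in lborel. (\<lambda>k. fourier F \<omega> * iexp (x * \<omega>) * of_real (exp (- (\<omega> / s k)\<^sup>2 / 2)))
        \<longlonglongrightarrow> fourier F \<omega> * iexp (x * \<omega>)"
    proof (intro AE_I2)
      fix \<omega>
      have "(\<lambda>k. fourier F \<omega> * iexp (x * \<omega>) * of_real (exp (- (\<omega> / s k)\<^sup>2 / 2)))
        \<longlonglongrightarrow> fourier F \<omega> * iexp (x * \<omega>) * of_real (exp (- 0\<^sup>2 / 2))"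
        by (intro tendsto_intros inv) simp
      then show "(\<lambda>k. fourier F \<omega> * iexp (x * \<omega>) * of_real (exp (- (\<omega> / s k)\<^sup>2 / 2)))
        \<longlonglongrightarrow> fourier F \<omega> * iexp (x * \<omega>)" by simp
    qed
    show "AE \<omega> in lborel. cmod (fourier F \<omega> * iexp (x * \<omega>) * of_real (exp (- (\<omega> / s k)\<^sup>2 / 2)))
        \<le> cmod (fourier F \<omega>)" for k
      by (intro AE_I2) (simp add: norm_mult mult_left_le)
  qed (use FF in auto)
  moreover have "?I \<longlonglongrightarrow> 2 * of_real pi * (CLINT t|lborel. of_real (std_normal_density t) * F x)"
    unfolding fourier_inversion_gaussian[OF F s]
  proof (intro tendsto_mult_left integral_dominated_convergence[where w = "\<lambda>t. M * std_normal_density t"])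
    show "AE t in lborel. (\<lambda>k. of_real (std_normal_density t) * F (x - t / s k))
        \<longlonglongrightarrow> of_real (std_normal_density t) * F x"
    proof (intro AE_I2 tendsto_mult_left)
      fix t
      have "(\<lambda>k. x - t / s k) \<longlonglongrightarrow> x - 0" by (intro tendsto_diff tendsto_const inv)
      then show "(\<lambda>k. F (x - t / s k)) \<longlonglongrightarrow> F x"
        using cont by (intro continuous_on_tendsto_compose[where s = UNIV and f = F]) auto
    qed
    show "AE t in lborel. cmod (of_real (std_normal_density t) * F (x - t / s k))
        \<le> M * std_normal_density t" for k
      by (intro AE_I2) (auto simp: norm_mult mult.commute[of M] intro!: mult_left_mono bdd)
  qed auto
  ultimately have "(CLINT \<omega>|lborel. fourier F \<omega> * iexp (x * \<omega>)) =
      2 * of_real pi * (CLINT t|lborel. of_real (std_normal_density t) * F x)"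
    by (rule LIMSEQ_unique)
  moreover have "(CLINT t|lborel. complex_of_real (std_normal_density t)) = 1"
    by (simp only: integral_complex_of_real integral_normal_density[of 1 0, simplified]) simp
  ultimately show ?thesis by simp
qed

section \<open>From decay of the transform to Hoelder continuous derivatives\<close>

lemma norm_iexp_diff_le: "cmod (iexp a - iexp b) \<le> \<bar>a - b\<bar>"
proof -
  have "iexp a - iexp b = iexp b * (iexp (a - b) - 1)"
    by (simp add: algebra_simps flip: exp_add)
  then have "cmod (iexp a - iexp b) = cmod (iexp (a - b) - 1)" by (simp add: norm_mult)
  also have "\<dots> \<le> \<bar>a - b\<bar>" using iexp_approx1[of "a - b" 0] by simp
  finally show ?thesis .
qed

text \<open>Interpolation between the bounds |a - b| and 2, according to whether |a - b| is at most
  1.\<close>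

lemma norm_iexp_diff_powr_le:
  assumes "0 \<le> \<alpha>" "\<alpha> < 1"
  shows "cmod (iexp a - iexp b) \<le> 2 * \<bar>a - b\<bar> powr \<alpha>"
proof (cases "a = b")
  case False
  then have pos: "\<bar>a - b\<bar> > 0" by simp
  show ?thesis
  proof (cases "\<bar>a - b\<bar> \<le> 1")
    case True
    have "\<bar>a - b\<bar> powr 1 \<le> \<bar>a - b\<bar> powr \<alpha>"
      using True pos assms by (intro powr_mono') auto
    then show ?thesis using norm_iexp_diff_le[of a b] pos by (simp add: powr_one)
  next
    case False
    have "cmod (iexp a - iexp b) \<le> 2"
      using norm_triangle_ineq4[of "iexp a" "iexp b"] by simp
    also have "\<dots> \<le> 2 * \<bar>a - b\<bar> powr \<alpha>"
      using False assms ge_one_powr_ge_zero[of "\<bar>a - b\<bar>" \<alpha>] by simp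
    finally show ?thesis .
  qed
qed simp

text \<open>Differentiation under the integral sign. The difference quotient minus the candidate
  derivative is the integral of h times the first-order remainder \<open>r\<close>, divided by y -
  x.\<close>

lemma fourier_integral_has_vector_derivative:
  fixes h :: "real \<Rightarrow> complex"
  assumes h: "integrable lborel h" and h1: "integrable lborel (\<lambda>\<omega>. (\<i> * of_real \<omega>) * h \<omega>)"
  shows "((\<lambda>x. CLINT \<omega>|lborel. h \<omega> * iexp (x * \<omega>)) has_vector_derivative
     (CLINT \<omega>|lborel. (\<i> * of_real \<omega> * h \<omega>) * iexp (x * \<omega>))) (at x)"
proof -
  have hm [measurable]: "h \<in> borel_measurable borel" using h by simp
  let ?G = "\<lambda>x. CLINT \<omega>|lborel. h \<omega> * iexp (x * \<omega>)"
  let ?G1 = "CLINT \<omega>|lborel. (\<i> * of_real \<omega> * h \<omega>) * iexp (x * \<omega>)"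
  define r where "r y \<omega> = (iexp (y * \<omega>) - iexp (x * \<omega>)) - (y - x) *\<^sub>R (\<i> * of_real \<omega> * iexp (x * \<omega>))" for y \<omega>
  have [measurable]: "(\<lambda>\<omega>. r y \<omega>) \<in> borel_measurable borel" for y unfolding r_def by measurable
  have int: "integrable lborel (\<lambda>\<omega>. h \<omega> * iexp (y * \<omega>))" for y
    using h by (rule Bochner_Integration.integrable_bound) (auto simp: norm_mult)
  have int1: "integrable lborel (\<lambda>\<omega>. (\<i> * of_real \<omega> * h \<omega>) * iexp (x * \<omega>))"
    using h1 by (rule Bochner_Integration.integrable_bound) (auto simp: norm_mult)
  have eq: "?G y - ?G x - (y - x) *\<^sub>R ?G1 = (CLINT \<omega>|lborel. h \<omega> * r y \<omega>)" for y
  proof -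
    have "?G y - ?G x - (y - x) *\<^sub>R ?G1 =
      (CLINT \<omega>|lborel. h \<omega> * iexp (y * \<omega>) - h \<omega> * iexp (x * \<omega>) - (y - x) *\<^sub>R ((\<i> * of_real \<omega> * h \<omega>) * iexp (x * \<omega>)))"
      using int int1 by simp
    also have "\<dots> = (CLINT \<omega>|lborel. h \<omega> * r y \<omega>)"
      by (rule Bochner_Integration.integral_cong) (auto simp: r_def algebra_simps)
    finally show ?thesis .
  qed
  \<comment> \<open>This crude first-order bound is only the majorant 2 |\<open>\<omega>\<close>|
    |h| after division by |y - x|; the smallness comes from the pointwise limit
    \<open>rlim\<close>.\<close>
  have rbound: "cmod (r y \<omega>) \<le> 2 * \<bar>\<omega>\<bar> * \<bar>y - x\<bar>" for y \<omega>
  proof -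
    have "cmod (r y \<omega>) \<le> cmod (iexp (y * \<omega>) - iexp (x * \<omega>)) + cmod ((y - x) *\<^sub>R (\<i> * of_real \<omega> * iexp (x * \<omega>)))"
      unfolding r_def by (rule norm_triangle_ineq4)
    also have "cmod (iexp (y * \<omega>) - iexp (x * \<omega>)) \<le> \<bar>\<omega>\<bar> * \<bar>y - x\<bar>"
    proof -
      have "\<bar>y * \<omega> - x * \<omega>\<bar> = \<bar>\<omega>\<bar> * \<bar>y - x\<bar>" by (metis abs_mult left_diff_distrib mult.commute)
      then show ?thesis using norm_iexp_diff_le[of "y * \<omega>" "x * \<omega>"] by simp
    qed
    finally show ?thesis by (simp add: norm_mult mult_ac)
  qed
  have rlim: "((\<lambda>y. cmod (r y \<omega>) / norm (y - x)) \<longlongrightarrow> 0) (at x)" for \<omega>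
  proof -
    have "((\<lambda>z. exp (\<i> * (z * of_real \<omega>))) has_field_derivative (\<i> * of_real \<omega> * iexp (x * \<omega>))) (at (of_real x))"
      by (auto intro!: derivative_eq_intros)
    from has_vector_derivative_real_field[OF this]
    have "((\<lambda>y. iexp (y * \<omega>)) has_vector_derivative (\<i> * of_real \<omega> * iexp (x * \<omega>))) (at x)"
      by simp
    then show ?thesis
      unfolding has_vector_derivative_def has_derivative_iff_norm r_def by simp
  qed
  have "((\<lambda>y. norm (?G y - ?G x - (y - x) *\<^sub>R ?G1) / norm (y - x)) \<longlongrightarrow> 0) (at x)"
    \<comment> \<open>Dominated convergence is a statement about sequences, so the limit at x is
      tested along them.\<close>
    unfolding tendsto_at_iff_sequentially comp_def
  proof (intro allI impI)
    fix X :: "nat \<Rightarrow> real"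
    assume X: "\<forall>i. X i \<in> UNIV - {x}" "X \<longlonglongrightarrow> x"
    have "(\<lambda>i. LINT \<omega>|lborel. cmod (h \<omega>) * (cmod (r (X i) \<omega>) / norm (X i - x))) \<longlonglongrightarrow> (LINT \<omega>|(lborel :: real measure). (0 :: real))"
    proof (rule integral_dominated_convergence[where w = "\<lambda>\<omega>. 2 * cmod (\<i> * of_real \<omega> * h \<omega>)"])
      show "integrable lborel (\<lambda>\<omega>. 2 * cmod (\<i> * of_real \<omega> * h \<omega>))" using h1 by auto
      show "AE \<omega> in lborel. (\<lambda>i. cmod (h \<omega>) * (cmod (r (X i) \<omega>) / norm (X i - x))) \<longlonglongrightarrow> 0"
      proof (intro AE_I2)
        fix \<omega>
        have "(\<lambda>i. cmod (r (X i) \<omega>) / norm (X i - x)) \<longlonglongrightarrow> 0"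
          using rlim[of \<omega>] X unfolding tendsto_at_iff_sequentially comp_def by blast
        then show "(\<lambda>i. cmod (h \<omega>) * (cmod (r (X i) \<omega>) / norm (X i - x))) \<longlonglongrightarrow> 0"
          by (rule tendsto_mult_right_zero)
      qed
      show "AE \<omega> in lborel. norm (cmod (h \<omega>) * (cmod (r (X i) \<omega>) / norm (X i - x)))
          \<le> 2 * cmod (\<i> * of_real \<omega> * h \<omega>)" for i
      proof (intro AE_I2)
        fix \<omega>
        have "cmod (r (X i) \<omega>) / norm (X i - x) \<le> 2 * \<bar>\<omega>\<bar>"
          using rbound[of "X i" \<omega>] X(1) by (simp add: divide_le_eq)
        then have "cmod (h \<omega>) * (cmod (r (X i) \<omega>) / norm (X i - x)) \<le> cmod (h \<omega>) * (2 * \<bar>\<omega>\<bar>)"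
          by (rule mult_left_mono) simp
        then show "norm (cmod (h \<omega>) * (cmod (r (X i) \<omega>) / norm (X i - x))) \<le> 2 * cmod (\<i> * of_real \<omega> * h \<omega>)"
          by (simp add: norm_mult mult_ac)
      qed
    qed measurable
    then have *: "(\<lambda>i. LINT \<omega>|lborel. cmod (h \<omega>) * (cmod (r (X i) \<omega>) / norm (X i - x))) \<longlonglongrightarrow> 0"
      by simp
    show "(\<lambda>i. norm (?G (X i) - ?G x - (X i - x) *\<^sub>R ?G1) / norm (X i - x)) \<longlonglongrightarrow> 0"
    proof (rule tendsto_sandwich[OF _ _ tendsto_const *])
      show "\<forall>\<^sub>F i in sequentially. norm (?G (X i) - ?G x - (X i - x) *\<^sub>R ?G1) / norm (X i - x)
        \<le> (LINT \<omega>|lborel. cmod (h \<omega>) * (cmod (r (X i) \<omega>) / norm (X i - x)))"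
      proof (intro always_eventually allI)
        fix i
        have "norm (?G (X i) - ?G x - (X i - x) *\<^sub>R ?G1) \<le> (LINT \<omega>|lborel. cmod (h \<omega> * r (X i) \<omega>))"
          unfolding eq by (rule integral_norm_bound)
        then have "norm (?G (X i) - ?G x - (X i - x) *\<^sub>R ?G1) / norm (X i - x)
            \<le> (LINT \<omega>|lborel. cmod (h \<omega> * r (X i) \<omega>)) / norm (X i - x)"
          by (rule divide_right_mono) simp
        also have "\<dots> = (LINT \<omega>|lborel. cmod (h \<omega>) * (cmod (r (X i) \<omega>) / norm (X i - x)))"
          by (subst integral_divide_zero[symmetric]) (simp add: norm_mult)
        finally show "norm (?G (X i) - ?G x - (X i - x) *\<^sub>R ?G1) / norm (X i - x)
          \<le> (LINT \<omega>|lborel. cmod (h \<omega>) * (cmod (r (X i) \<omega>) / norm (X i - x)))" .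
      qed
    qed simp
  qed
  then show ?thesis
    unfolding has_vector_derivative_def has_derivative_iff_norm
    by (simp add: bounded_linear_scaleR_left)
qed

lemma fourier_integral_has_nth_derivative:
  fixes h :: "real \<Rightarrow> complex"
  assumes "\<And>j. j \<le> l \<Longrightarrow> integrable lborel (\<lambda>\<omega>. (\<i> * of_real \<omega>) ^ j * h \<omega>)"
  shows "has_nth_derivative l (\<lambda>x. CLINT \<omega>|lborel. h \<omega> * iexp (x * \<omega>))
    (\<lambda>x. CLINT \<omega>|lborel. ((\<i> * of_real \<omega>) ^ l * h \<omega>) * iexp (x * \<omega>))"
  using assms
proof (induction l arbitrary: h)
  case (Suc l)
  have "has_nth_derivative l (\<lambda>x. CLINT \<omega>|lborel. (\<i> * of_real \<omega> * h \<omega>) * iexp (x * \<omega>))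
    (\<lambda>x. CLINT \<omega>|lborel. ((\<i> * of_real \<omega>) ^ l * (\<i> * of_real \<omega> * h \<omega>)) * iexp (x * \<omega>))"
  proof (rule Suc.IH)
    fix j assume "j \<le> l"
    then show "integrable lborel (\<lambda>\<omega>. (\<i> * of_real \<omega>) ^ j * (\<i> * of_real \<omega> * h \<omega>))"
      using Suc.prems[of "Suc j"] by (simp add: mult_ac)
  qed
  moreover have "((\<lambda>x. CLINT \<omega>|lborel. h \<omega> * iexp (x * \<omega>)) has_vector_derivative
     (CLINT \<omega>|lborel. (\<i> * of_real \<omega> * h \<omega>) * iexp (x * \<omega>))) (at x)" for x
    using Suc.prems[of 0] Suc.prems[of 1]
    by (intro fourier_integral_has_vector_derivative) auto
  moreover have "(\<i> * of_real \<omega>) ^ Suc l * h \<omega> = (\<i> * of_real \<omega>) ^ l * (\<i> * of_real \<omega> * h \<omega>)" for \<omega>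
    by (simp add: mult_ac)
  ultimately show ?case
    unfolding has_nth_derivative.simps
    by (intro exI[of _ "\<lambda>x. CLINT \<omega>|lborel. (\<i> * of_real \<omega> * h \<omega>) * iexp (x * \<omega>)"]) (simp only: simp_thms)
qed simp

lemma integrable_powr_decay:
  fixes p :: real
  assumes p: "p > 1"
  shows "integrable lborel (\<lambda>x. (\<bar>x\<bar> + 1) powr (- p))"
proof -
  define q where "q = p - 1"
  have q: "q > 0" using p by (simp add: q_def)
  let ?f = "\<lambda>x. indicator {0..} x * (x + 1) powr (- p) :: real"
  have nn: "(\<integral>\<^sup>+x. ennreal ((x + 1) powr (- p)) * indicator {0..} x \<partial>lborel) =
      ennreal (0 - (- ((0 + 1) powr (- q) / q)))"
  proof (rule nn_integral_FTC_atLeast)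
    show "((\<lambda>x. - ((x + 1) powr (- q) / q)) \<longlongrightarrow> 0) at_top"
    proof -
      have "filterlim (\<lambda>x :: real. x + 1) at_top at_top"
        by (subst add.commute) (rule filterlim_tendsto_add_at_top[OF tendsto_const filterlim_ident])
      then have "((\<lambda>x. (x + 1) powr (- q)) \<longlongrightarrow> 0) at_top"
        using q by (intro tendsto_neg_powr) auto
      then have "((\<lambda>x. - ((x + 1) powr (- q) / q)) \<longlongrightarrow> - (0 / q)) at_top"
        using q by (intro tendsto_minus tendsto_divide tendsto_const) auto
      then show ?thesis by simp
    qed
    have pq: "- p = - q - 1" by (simp add: q_def)
    fix x :: real assume "0 \<le> x"
    then show "DERIV (\<lambda>x. - ((x + 1) powr (- q) / q)) x :> (x + 1) powr (- p)"
      unfolding pq using q by (auto intro!: derivative_eq_intros)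
  qed auto
  have f: "integrable lborel ?f"
  proof (rule integrableI_bounded)
    have "(\<integral>\<^sup>+x. ennreal (norm (?f x)) \<partial>lborel) = (\<integral>\<^sup>+x. ennreal ((x + 1) powr (- p)) * indicator {0..} x \<partial>lborel)"
      by (intro nn_integral_cong) (auto simp: indicator_def)
    then show "(\<integral>\<^sup>+x. ennreal (norm (?f x)) \<partial>lborel) < \<infinity>" by (simp add: nn)
  qed measurable
  have "integrable lborel (\<lambda>x. ?f (0 + (-1) * x))"
    by (rule lborel_integrable_real_affine[OF f]) simp
  \<comment> \<open>The two half-line functions overlap at 0, where the sum is doubled; as a
    majorant this does no harm.\<close>
  then have "integrable lborel (\<lambda>x. ?f x + ?f (0 + (-1) * x))"
    using f by (rule Bochner_Integration.integrable_add[rotated])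
  then show ?thesis
    by (rule Bochner_Integration.integrable_bound) (auto simp: indicator_def)
qed

text \<open>Of the exponent l + 1 + \<open>\<alpha>\<close> + \<open>\<epsilon>\<close>, l powers
  pay for the derivatives and \<open>\<alpha>\<close> for the Hoelder estimate; the remaining 1 +
  \<open>\<epsilon>\<close> is integrable.\<close>

lemma fourier_decay_imp_Lip_derivative:
  fixes F :: "real \<Rightarrow> complex"
  assumes cont: "continuous_on UNIV F" and supp: "\<And>x. \<bar>x\<bar> > R \<Longrightarrow> F x = 0"
    and \<alpha>: "0 \<le> \<alpha>" "\<alpha> < 1" and \<epsilon>: "\<epsilon> > 0"
    and decay: "\<And>\<omega>. cmod (fourier F \<omega>) \<le> C * (\<bar>\<omega>\<bar> + 1) powr (- real l - 1 - \<alpha> - \<epsilon>)"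
  shows "\<exists>g. has_nth_derivative l F g \<and> g \<in> Lip \<alpha>"
proof -
  have Fm [measurable]: "F \<in> borel_measurable borel"
    using cont by (rule borel_measurable_continuous_onI)
  have C: "C \<ge> 0" using order_trans[OF norm_ge_zero decay[of 0]] by simp
  have "compact (F ` {- R..R})"
    using cont by (intro compact_continuous_image) (auto intro: continuous_on_subset)
  then obtain M where M: "\<And>x. x \<in> {- R..R} \<Longrightarrow> cmod (F x) \<le> M"
    by (meson bounded_iff compact_imp_bounded imageI)
  have bdd: "cmod (F x) \<le> \<bar>M\<bar>" for x
    using M[of x] supp[of x] by (cases "\<bar>x\<bar> > R") (force simp: not_less abs_le_iff)+
  have F: "integrable lborel F"
  proof (rule Bochner_Integration.integrable_bound)
    show "integrable lborel (\<lambda>x. \<bar>M\<bar> * indicator {- R..R} x :: real)"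
      by (intro integrable_mult_right integrable_real_indicator) (auto simp: emeasure_lborel_Icc_eq)
    show "AE x in lborel. norm (F x) \<le> norm (\<bar>M\<bar> * indicator {- R..R} x :: real)"
    proof (intro AE_I2)
      fix x
      show "norm (F x) \<le> norm (\<bar>M\<bar> * indicator {- R..R} x :: real)"
        using bdd[of x] supp[of x] by (cases "\<bar>x\<bar> > R") (auto simp: indicator_def)
    qed
  qed simp
  define W where "W \<omega> = C * (\<bar>\<omega>\<bar> + 1) powr (- (1 + \<epsilon>))" for \<omega> :: real
  have W: "integrable lborel W"
    unfolding W_def using \<epsilon> by (intro integrable_mult_right integrable_powr_decay) simp
  \<comment> \<open>Used with b = 0 for the integrability of the derivatives and with b =
    \<open>\<alpha>\<close> for the Hoelder estimate.\<close>
  have bound: "\<bar>\<omega>\<bar> powr b * cmod ((\<i> * of_real \<omega>) ^ j * fourier F \<omega>) \<le> W \<omega>"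
    if "j \<le> l" "0 \<le> b" "b \<le> \<alpha>" for j b \<omega>
  proof -
    have "\<bar>\<omega>\<bar> powr b * cmod ((\<i> * of_real \<omega>) ^ j * fourier F \<omega>) =
       \<bar>\<omega>\<bar> powr b * (\<bar>\<omega>\<bar> ^ j * cmod (fourier F \<omega>))"
      by (simp add: norm_mult norm_power)
    also have "\<dots> \<le> (\<bar>\<omega>\<bar> + 1) powr \<alpha> * ((\<bar>\<omega>\<bar> + 1) powr real l *
        (C * (\<bar>\<omega>\<bar> + 1) powr (- real l - 1 - \<alpha> - \<epsilon>)))"
    proof (intro mult_mono decay)
      show "\<bar>\<omega>\<bar> powr b \<le> (\<bar>\<omega>\<bar> + 1) powr \<alpha>"
        using that by (intro order_trans[OF powr_mono2[of b "\<bar>\<omega>\<bar>" "\<bar>\<omega>\<bar> + 1"] powr_mono]) auto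
      have "\<bar>\<omega>\<bar> ^ j \<le> (\<bar>\<omega>\<bar> + 1) ^ l"
        using that by (intro order_trans[OF power_mono[of "\<bar>\<omega>\<bar>" "\<bar>\<omega>\<bar> + 1"] power_increasing]) auto
      then show "\<bar>\<omega>\<bar> ^ j \<le> (\<bar>\<omega>\<bar> + 1) powr real l" by (subst powr_realpow) auto
    qed (use C in auto)
    also have "\<dots> = W \<omega>"
    proof -
      have "- (1 + \<epsilon>) = \<alpha> + (real l + (- real l - 1 - \<alpha> - \<epsilon>))" by simp
      then show ?thesis unfolding W_def by (simp only: powr_add mult_ac)
    qed
    finally show ?thesis .
  qed
  have int: "integrable lborel (\<lambda>\<omega>. (\<i> * of_real \<omega>) ^ j * fourier F \<omega>)" if "j \<le> l" for j
  proof (rule Bochner_Integration.integrable_bound[OF W])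
    show "AE \<omega> in lborel. norm ((\<i> * of_real \<omega>) ^ j * fourier F \<omega>) \<le> norm (W \<omega>)"
    \<comment> \<open>At \<open>\<omega>\<close> = 0 the bound with b = 0 says nothing, since
      \<open>0 powr 0 = 0\<close>; that point is a null set.\<close>
    proof (rule AE_mp[OF AE_lborel_singleton[of 0]], intro AE_I2 impI)
      fix \<omega> :: real assume "\<omega> \<noteq> 0"
      then show "norm ((\<i> * of_real \<omega>) ^ j * fourier F \<omega>) \<le> norm (W \<omega>)"
        using bound[of j 0 \<omega>] that \<alpha> by simp
    qed
  qed measurable
  have FF: "integrable lborel (fourier F)" using int[of 0] by simp
  define h where "h \<omega> = fourier F \<omega> / (2 * of_real pi)" for \<omega>
  have hint: "integrable lborel (\<lambda>\<omega>. (\<i> * of_real \<omega>) ^ j * h \<omega>)" if "j \<le> l" for j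
    unfolding h_def using integrable_divide_zero[OF int[OF that], of "2 * of_real pi"] by simp
  define g where "g x = (CLINT \<omega>|lborel. ((\<i> * of_real \<omega>) ^ l * h \<omega>) * iexp (x * \<omega>))" for x
  have "F = (\<lambda>x. CLINT \<omega>|lborel. h \<omega> * iexp (x * \<omega>))"
    using fourier_inversion[OF cont bdd F FF] by (auto simp: h_def)
  then have "has_nth_derivative l F g"
    using fourier_integral_has_nth_derivative[OF hint] unfolding g_def by simp
  moreover have "g \<in> Lip \<alpha>"
  proof -
    have hm [measurable]: "h \<in> borel_measurable borel" unfolding h_def by measurable
    define L where "L = (LINT \<omega>|lborel. W \<omega>)"
    have L: "L \<ge> 0" unfolding L_def W_def using C by (intro integral_nonneg_AE) auto
    have "cmod (g x - g y) \<le> L * \<bar>x - y\<bar> powr \<alpha>" for x y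
    proof -
      let ?k = "\<lambda>\<omega>. (\<i> * of_real \<omega>) ^ l * h \<omega>"
      have i: "integrable lborel (\<lambda>\<omega>. ?k \<omega> * iexp (x * \<omega>))" for x
        using hint[of l] by (intro Bochner_Integration.integrable_bound[OF hint[of l]]) (auto simp: norm_mult)
      have "g x - g y = (CLINT \<omega>|lborel. ?k \<omega> * iexp (x * \<omega>) - ?k \<omega> * iexp (y * \<omega>))"
        unfolding g_def by (rule Bochner_Integration.integral_diff[OF i i, symmetric])
      also have "cmod \<dots> \<le> (LINT \<omega>|lborel. W \<omega> * \<bar>x - y\<bar> powr \<alpha>)"
      proof (rule Bochner_Integration.integral_norm_bound_integral)
        show "integrable lborel (\<lambda>\<omega>. ?k \<omega> * iexp (x * \<omega>) - ?k \<omega> * iexp (y * \<omega>))"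
          by (rule Bochner_Integration.integrable_diff[OF i i])
        show "integrable lborel (\<lambda>\<omega>. W \<omega> * \<bar>x - y\<bar> powr \<alpha>)" using W by simp
        fix \<omega> :: real
        have "cmod (?k \<omega> * iexp (x * \<omega>) - ?k \<omega> * iexp (y * \<omega>)) =
           cmod (?k \<omega>) * cmod (iexp (x * \<omega>) - iexp (y * \<omega>))"
          by (simp only: right_diff_distrib[symmetric] norm_mult)
        also have "\<dots> \<le> cmod (?k \<omega>) * (2 * \<bar>x * \<omega> - y * \<omega>\<bar> powr \<alpha>)"
          by (rule mult_left_mono[OF norm_iexp_diff_powr_le[OF \<alpha>]]) simp
        also have "\<bar>x * \<omega> - y * \<omega>\<bar> powr \<alpha> = \<bar>x - y\<bar> powr \<alpha> * \<bar>\<omega>\<bar> powr \<alpha>"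
          by (simp add: abs_mult powr_mult flip: left_diff_distrib)
        also have "cmod (?k \<omega>) * (2 * (\<bar>x - y\<bar> powr \<alpha> * \<bar>\<omega>\<bar> powr \<alpha>)) =
           (\<bar>\<omega>\<bar> powr \<alpha> * cmod ((\<i> * of_real \<omega>) ^ l * fourier F \<omega>)) * \<bar>x - y\<bar> powr \<alpha> / pi"
          by (simp add: h_def norm_mult norm_divide)
        \<comment> \<open>The 2 of the Hoelder bound over the 2 pi of the inversion formula leaves 1
          / pi, which is dropped.\<close>
        also have "\<dots> \<le> (\<bar>\<omega>\<bar> powr \<alpha> * cmod ((\<i> * of_real \<omega>) ^ l * fourier F \<omega>)) * \<bar>x - y\<bar> powr \<alpha> / 1"
          using pi_gt3 by (intro divide_left_mono) auto
        also have "\<dots> \<le> W \<omega> * \<bar>x - y\<bar> powr \<alpha>"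
          using bound[of l \<alpha> \<omega>] \<alpha> by (simp add: mult_right_mono)
        finally show "cmod (?k \<omega> * iexp (x * \<omega>) - ?k \<omega> * iexp (y * \<omega>)) \<le> W \<omega> * \<bar>x - y\<bar> powr \<alpha>" .
      qed
      also have "\<dots> = L * \<bar>x - y\<bar> powr \<alpha>" by (simp add: L_def)
      finally show ?thesis .
    qed
    \<comment> \<open>\<open>L\<close> may be 0, whereas \<open>Lip\<close> asks for a positive
      constant.\<close>
    then have "cmod (g x - g y) \<le> (L + 1) * \<bar>x - y\<bar> powr \<alpha>" for x y
      by (rule order_trans) (simp add: mult_right_mono)
    then show ?thesis using L unfolding Lip_def by (auto intro!: exI[of _ "L + 1"])
  qed
  ultimately show ?thesis by blast
qed

section \<open>Comparison of the two infinite products\<close>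

lemma pow2_exp_minus_1_tendsto:
  fixes a :: complex
  shows "(\<lambda>N. 2 ^ N * (exp (a / 2 ^ N) - 1)) \<longlonglongrightarrow> a"
proof (cases "a = 0")
  case False
  have "((\<lambda>h. (exp (0 + h) - exp 0) / h) \<longlongrightarrow> exp 0) (at (0 :: complex))"
    using DERIV_exp[of "0 :: complex"] by (simp add: has_field_derivative_iff)
  then have "((\<lambda>h. (exp h - 1) / h) \<longlongrightarrow> 1) (at (0 :: complex))" by simp
  moreover have "filterlim (\<lambda>N. a / 2 ^ N) (at 0) sequentially"
  proof (rule filterlim_atI)
    have "(\<lambda>N. a * (1/2) ^ N) \<longlonglongrightarrow> a * 0"
      by (intro tendsto_mult_left LIMSEQ_power_zero) auto
    then show "(\<lambda>N. a / 2 ^ N) \<longlonglongrightarrow> 0" by (simp add: power_one_over)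
  qed (use False in auto)
  ultimately have "(\<lambda>N. (exp (a / 2 ^ N) - 1) / (a / 2 ^ N)) \<longlonglongrightarrow> 1"
    by (rule filterlim_compose)
  then have "(\<lambda>N. a * ((exp (a / 2 ^ N) - 1) / (a / 2 ^ N))) \<longlonglongrightarrow> a * 1"
    by (rule tendsto_mult_left)
  then show ?thesis using False by (simp add: field_simps)
qed simp

text \<open>Telescoping through \<open>(e\<^sup>x - e\<^sup>y) (e\<^sup>x + e\<^sup>y) = e\<^sup>2\<^sup>x - e\<^sup>2\<^sup>y\<close>.\<close>

lemma prod_exp_mean_tendsto:
  fixes a b :: complex
  assumes "a \<noteq> b"
  shows "(\<lambda>N. \<Prod>k<N. (exp (a / 2 ^ (k + 1)) + exp (b / 2 ^ (k + 1))) / 2)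
     \<longlonglongrightarrow> (exp a - exp b) / (a - b)"
proof -
  define P where "P N = (\<Prod>k<N. (exp (a / 2 ^ (k + 1)) + exp (b / 2 ^ (k + 1))) / 2)" for N
  define Q where "Q N = 2 ^ N * (exp (a / 2 ^ N) - exp (b / 2 ^ N))" for N
  have tele: "P N * Q N = exp a - exp b" for N
  proof (induction N)
    case (Suc N)
    have "exp (c / 2 ^ N) = exp (c / 2 ^ Suc N) ^ 2" for c :: complex
      by (simp add: exp_double[symmetric])
    then have "(exp (a / 2 ^ Suc N) + exp (b / 2 ^ Suc N)) / 2 * Q (Suc N) = Q N"
      unfolding Q_def by (simp add: power2_eq_square algebra_simps)
    then show ?case using Suc by (simp add: P_def mult.assoc)
  qed (simp add: P_def Q_def)
  have "(\<lambda>N. 2 ^ N * (exp (a / 2 ^ N) - 1) - 2 ^ N * (exp (b / 2 ^ N) - 1)) \<longlonglongrightarrow> a - b"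
    by (intro tendsto_diff pow2_exp_minus_1_tendsto)
  then have Q: "Q \<longlonglongrightarrow> a - b"
    by (simp add: Q_def[abs_def] algebra_simps)
  then have "(\<lambda>N. (exp a - exp b) / Q N) \<longlonglongrightarrow> (exp a - exp b) / (a - b)"
    using assms by (intro tendsto_divide tendsto_const) auto
  moreover have "\<forall>\<^sub>F N in sequentially. (exp a - exp b) / Q N = P N"
  proof -
    have "\<forall>\<^sub>F N in sequentially. Q N \<noteq> 0"
      using assms by (intro tendsto_imp_eventually_ne[OF Q]) auto
    then show ?thesis by eventually_elim (simp add: nonzero_divide_eq_eq tele)
  qed
  ultimately have "P \<longlonglongrightarrow> (exp a - exp b) / (a - b)"
    by (rule Lim_transform_eventually)
  then show ?thesis by (simp add: P_def[abs_def])
qed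

text \<open>As the cofactor has no zeros on the unit circle, perturbing the polynomial and its argument
  only costs factors \<open>1 + O(2\<^sup>-\<^sup>k)\<close>.\<close>

lemma prod_cofactor_le:
  fixes B0 :: "complex poly" and B :: "nat \<Rightarrow> complex poly"
  assumes nz: "\<And>z. cmod z = 1 \<Longrightarrow> poly B0 z \<noteq> 0"
    and B: "\<And>k. coeff_norm (B k - B0) \<le> K * (1/2) ^ k" and "0 \<le> \<delta>"
  shows "\<exists>Q>0. \<forall>u v N. (\<forall>k. cmod (u k) = 1 \<and> cmod (v k) = 1 \<and> cmod (u k - v k) \<le> \<delta> * (1/2) ^ k) \<longrightarrow>
     (\<Prod>k<N. cmod (poly (B k) (u k))) \<le> Q * (\<Prod>k<N. cmod (poly B0 (v k)))"
proof -
  have K: "K \<ge> 0" using order_trans[OF coeff_norm_nonneg B[of 0]] by simp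
  obtain L where L: "L \<ge> 0" "\<And>u v. cmod u \<le> 1 \<Longrightarrow> cmod v \<le> 1 \<Longrightarrow>
    cmod (poly B0 u - poly B0 v) \<le> L * cmod (u - v)"
    using poly_Lipschitz_unit_disc by blast
  have "\<exists>x\<in>sphere 0 1. \<forall>y\<in>sphere 0 1. cmod (poly B0 x) \<le> cmod (poly B0 y)"
  proof (rule continuous_attains_inf)
    show "sphere (0 :: complex) 1 \<noteq> {}" by simp
  qed (auto intro!: continuous_intros)
  then obtain x where x: "cmod x = 1" "\<And>y. cmod y = 1 \<Longrightarrow> cmod (poly B0 x) \<le> cmod (poly B0 y)"
    by (auto simp: dist_norm)
  define b where "b = cmod (poly B0 x)"
  have b: "b > 0" using nz x(1) by (simp add: b_def)
  \<comment> \<open>The additive error (K + L \<open>\<delta>\<close>) 2^-k becomes relative once it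
    is divided by the minimum b of the modulus of \<open>B0\<close> on the circle.\<close>
  define c where "c = (K + L * \<delta>) / b"
  have c: "c \<ge> 0" using K L b \<open>0 \<le> \<delta>\<close> by (simp add: c_def)
  show ?thesis
  \<comment> \<open>The factors exp (c 2^-k) multiply to at most exp (2 c), whatever the points and
    the number of factors.\<close>
  proof (intro exI[of _ "exp (2 * c)"] conjI allI impI)
    fix u v :: "nat \<Rightarrow> complex" and N
    assume "\<forall>k. cmod (u k) = 1 \<and> cmod (v k) = 1 \<and> cmod (u k - v k) \<le> \<delta> * (1/2) ^ k"
    then have u: "\<And>k. cmod (u k) = 1" and v: "\<And>k. cmod (v k) = 1"
      and uv: "\<And>k. cmod (u k - v k) \<le> \<delta> * (1/2) ^ k"
      by auto
    have step: "cmod (poly (B k) (u k)) \<le> exp (c * (1/2) ^ k) * cmod (poly B0 (v k))" for k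
    proof -
      have "poly (B k) (u k) = poly B0 (v k) + (poly B0 (u k) - poly B0 (v k)) + poly (B k - B0) (u k)"
        by simp
      also have "cmod \<dots> \<le> cmod (poly B0 (v k)) + cmod (poly B0 (u k) - poly B0 (v k)) + cmod (poly (B k - B0) (u k))"
        by (intro order_trans[OF norm_triangle_ineq] add_mono norm_triangle_ineq) simp
      also have "\<dots> \<le> cmod (poly B0 (v k)) + L * (\<delta> * (1/2) ^ k) + K * (1/2) ^ k"
      proof (intro add_mono order_refl)
        show "cmod (poly B0 (u k) - poly B0 (v k)) \<le> L * (\<delta> * (1/2) ^ k)"
          using L(2)[of "u k" "v k"] u v uv[of k] L(1) by (auto intro: order_trans mult_left_mono)
        show "cmod (poly (B k - B0) (u k)) \<le> K * (1/2) ^ k"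
          using norm_poly_le_coeff_norm[of "u k" "B k - B0"] u B[of k] by (auto intro: order_trans)
      qed
      also have "\<dots> = cmod (poly B0 (v k)) + c * (1/2) ^ k * b"
      proof -
        have "c * (1/2) ^ k * b = (c * b) * (1/2) ^ k" by simp
        also have "c * b = K + L * \<delta>" using b by (simp add: c_def)
        finally show ?thesis by (simp add: algebra_simps)
      qed
      also have "\<dots> \<le> cmod (poly B0 (v k)) + c * (1/2) ^ k * cmod (poly B0 (v k))"
        using x(2)[OF v[of k]] c unfolding b_def by (intro add_left_mono mult_left_mono) auto
      also have "\<dots> = (1 + c * (1/2) ^ k) * cmod (poly B0 (v k))" by (simp add: algebra_simps)
      also have "\<dots> \<le> exp (c * (1/2) ^ k) * cmod (poly B0 (v k))"
        by (intro mult_right_mono exp_ge_add_one_self) simp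
      finally show ?thesis .
    qed
    have "(\<Prod>k<N. cmod (poly (B k) (u k))) \<le> (\<Prod>k<N. exp (c * (1/2) ^ k) * cmod (poly B0 (v k)))"
      by (intro prod_mono conjI step) simp
    also have "\<dots> = exp (\<Sum>k<N. c * (1/2) ^ k) * (\<Prod>k<N. cmod (poly B0 (v k)))"
      by (simp add: prod.distrib exp_sum)
    also have "\<dots> \<le> exp (2 * c) * (\<Prod>k<N. cmod (poly B0 (v k)))"
    proof (intro mult_right_mono prod_nonneg)
      have "(\<Sum>k<N. c * (1/2) ^ k) = c * (\<Sum>k<N. (1/2) ^ k)" by (simp add: sum_distrib_left)
      also have "\<dots> \<le> c * 2"
        using c by (intro mult_left_mono) (auto simp: geometric_sum)
      finally show "exp (\<Sum>k<N. c * (1/2) ^ k) \<le> exp (2 * c)" by simp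
    qed auto
    finally show "(\<Prod>k<N. cmod (poly (B k) (u k))) \<le> exp (2 * c) * (\<Prod>k<N. cmod (poly B0 (v k)))" .
  qed simp
qed

text \<open>The power of u has modulus 1 and drops out. Halving each of the 2n linear factors
  overuses the single 1/2 of the symbol by 2^(2n-1) per level; this surplus is common to both
  schemes and cancels in the comparison.\<close>

lemma norm_prod_symbol:
  fixes a :: "nat \<Rightarrow> int \<Rightarrow> complex" and x :: "nat \<Rightarrow> nat \<Rightarrow> complex"
  assumes fac: "\<And>k. symbol (a k) (u k) * u k ^ (2 * n - 1) = (\<Prod>j<2 * n. u k + x k j) * poly (B k) (u k)"
    and u: "\<And>k. cmod (u k) = 1" and n: "n \<ge> 1"
  shows "cmod (\<Prod>k<N. symbol (a k) (u k) / 2) =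
     (\<Prod>j<2 * n. cmod (\<Prod>k<N. (u k + x k j) / 2)) * (2 ^ (2 * n - 1)) ^ N *
     (\<Prod>k<N. cmod (poly (B k) (u k)))"
proof -
  have "cmod (symbol (a k) (u k) / 2) =
     (\<Prod>j<2 * n. cmod ((u k + x k j) / 2)) * 2 ^ (2 * n - 1) * cmod (poly (B k) (u k))" for k
  proof -
    have "cmod (symbol (a k) (u k)) = cmod (symbol (a k) (u k) * u k ^ (2 * n - 1))"
      using u by (simp add: norm_mult norm_power)
    also have "\<dots> = (\<Prod>j<2 * n. cmod (u k + x k j)) * cmod (poly (B k) (u k))"
      unfolding fac by (simp add: norm_mult prod_norm)
    finally have "cmod (symbol (a k) (u k)) = (\<Prod>j<2 * n. cmod (u k + x k j)) * cmod (poly (B k) (u k))" .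
    moreover have "(2 :: real) ^ (2 * n) = 2 * 2 ^ (2 * n - 1)"
      using n by (cases n) auto
    ultimately show ?thesis by (simp add: norm_divide prod_dividef)
  qed
  then show ?thesis
    by (simp add: prod.distrib flip: prod_norm) (simp add: prod.swap[of _ "{..<N}"])
qed

text \<open>The midpoint of the period interval [2 pi q, 2 pi (q + 1)) containing
  \<open>\<omega>\<close>.\<close>

lemma odd_multiple_of_pi_near:
  obtains \<omega>' where "\<bar>\<omega> - \<omega>'\<bar> \<le> pi" "iexp (- \<omega>') = - 1" "\<omega>' \<noteq> 0"
proof -
  define q where "q = \<lfloor>\<omega> / (2 * pi)\<rfloor>"
  define \<omega>' where "\<omega>' = (2 * of_int q + 1) * pi"
  have "of_int q \<le> \<omega> / (2 * pi)" "\<omega> / (2 * pi) < of_int q + 1"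
    unfolding q_def by linarith+
  then have "of_int q * (2 * pi) \<le> \<omega>" "\<omega> < (of_int q + 1) * (2 * pi)"
    by (simp_all add: field_simps)
  then have 1: "\<bar>\<omega> - \<omega>'\<bar> \<le> pi" by (simp add: \<omega>'_def abs_le_iff algebra_simps)
  have 2: "iexp (- \<omega>') = - 1"
  proof -
    have "iexp (- \<omega>') = exp (2 * of_int (- q) * pi * \<i>) * exp (- (of_real pi * \<i>))"
      by (simp add: \<omega>'_def algebra_simps flip: exp_add)
    also have "exp (2 * of_int (- q) * pi * \<i>) = 1"
      by (subst exp_integer_2pi) auto
    finally show ?thesis by (simp add: exp_minus)
  qed
  then have "\<omega>' \<noteq> 0" by auto
  with 1 2 show ?thesis using that by blast
qed

section \<open>Transfer of the decay, and conclusion\<close>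

lemma interpolatory_mask_support:
  assumes "is_interpolatory_scheme n lam a" "\<bar>j\<bar> > 2 * int n - 1"
  shows "a k j = 0"
  using assms by (simp add: is_interpolatory_scheme_def is_interpolatory_mask_def)

lemma fourier_decay_transfer:
  fixes lam :: "nat \<Rightarrow> real"
  assumes n: "n \<ge> 1" and dd: "is_Deslauriers_Dubuc_scheme n d" and \<Phi>D: "is_basic_limit_function d \<Phi>D"
    and a: "is_interpolatory_scheme n lam a" and \<Phi>: "is_basic_limit_function (\<lambda>k. a (k + m)) \<Phi>"
  obtains H where "H > 0" "\<And>\<omega>. \<bar>\<omega>\<bar> \<ge> 1 \<Longrightarrow>
     \<exists>\<omega>'. \<bar>\<omega> - \<omega>'\<bar> \<le> pi \<and> cmod (fourier \<Phi> \<omega>) \<le> H * cmod (fourier \<Phi>D \<omega>')"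
proof -
  obtain B K where K: "K \<ge> 0" and B: "\<And>k. coeff_norm (B k - dd_cofactor n) \<le> K * (1/2) ^ k"
    and fac: "\<And>k z. z \<noteq> 0 \<Longrightarrow> symbol (a k) z * z ^ (2 * n - 1) =
       (\<Prod>j<2 * n. z + of_real (exp (- (lam j / 2 ^ (k + 1))))) * poly (B k) z"
    by (rule interpolatory_scheme_factorization[OF n a], rule that, assumption+)
  have facD: "symbol (d k) z * z ^ (2 * n - 1) = (\<Prod>j<2 * n. z + 1) * poly (dd_cofactor n) z"
    if z: "z \<noteq> 0" for k z
  proof -
    have "is_interpolatory_scheme n (\<lambda>_. 0) d" using dd by (simp add: is_Deslauriers_Dubuc_scheme_def)
    then show ?thesis
    proof (rule interpolatory_scheme_factorization[OF n])
      fix BD :: "nat \<Rightarrow> complex poly"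
      assume "\<And>k z. z \<noteq> 0 \<Longrightarrow> symbol (d k) z * z ^ (2 * n - 1) =
         (\<Prod>j<2 * n. z + of_real (exp (- (0 / 2 ^ (k + 1))))) * poly (BD k) z"
        and "(\<And>j. j < 2 * n \<Longrightarrow> (0 :: real) = 0) \<Longrightarrow> BD = (\<lambda>_. dd_cofactor n)"
      then show ?thesis using z by simp
    qed
  qed
  have B': "coeff_norm (B (k + m) - dd_cofactor n) \<le> K * (1/2) ^ k" for k
  proof -
    have "K * (1/2) ^ (k + m) \<le> K * (1/2) ^ k"
      using K by (intro mult_left_mono power_decreasing) auto
    then show ?thesis using B[of "k + m"] by linarith
  qed
  \<comment> \<open>The 4 comes from |\<open>\<omega>\<close> - \<open>\<omega>'\<close>| <= pi < 8:
    the points at level k are at most 8 / 2^(k+1) apart.\<close>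
  obtain Q where Q: "Q > 0" "\<And>u v N. \<forall>k. cmod (u k) = 1 \<and> cmod (v k) = 1 \<and> cmod (u k - v k) \<le> 4 * (1/2) ^ k \<Longrightarrow>
     (\<Prod>k<N. cmod (poly (B (k + m)) (u k))) \<le> Q * (\<Prod>k<N. cmod (poly (dd_cofactor n) (v k)))"
    using prod_cofactor_le[of "dd_cofactor n" "\<lambda>k. B (k + m)" K 4, OF dd_cofactor_nonzero[OF n] B'] by auto
  \<comment> \<open>Starting the scheme at level m amounts to replacing each \<open>lam j\<close> by
    \<open>lam j / 2 ^ m\<close> in the roots.\<close>
  define \<tau> where "\<tau> j = lam j / 2 ^ m" for j
  define G where "G = (\<Prod>j<2 * n. 1 + exp (- \<tau> j))"
  have G: "G > 0" unfolding G_def by (intro prod_pos) (simp add: add_pos_pos)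
  \<comment> \<open>For |\<open>\<omega>\<close>| >= 1 one has |\<open>\<omega>'\<close>| <=
    |\<open>\<omega>\<close>| + 4 <= 5 |\<open>\<omega>\<close>|; the half in 5/2 stems from the
    limit 2 / |\<open>\<omega>'\<close>|.\<close>
  have "\<exists>\<omega>'. \<bar>\<omega> - \<omega>'\<bar> \<le> pi \<and> cmod (fourier \<Phi> \<omega>) \<le> (Q * G * (5/2) ^ (2 * n)) * cmod (fourier \<Phi>D \<omega>')"
    if \<omega>: "\<bar>\<omega>\<bar> \<ge> 1" for \<omega>
  proof -
    obtain \<omega>' where \<omega>': "\<bar>\<omega> - \<omega>'\<bar> \<le> pi" "iexp (- \<omega>') = - 1" "\<omega>' \<noteq> 0"
      by (rule odd_multiple_of_pi_near)
    define u v where "u k = exp (- (\<i> * of_real (\<omega> / 2 ^ (k + 1))))"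
      and "v k = exp (- (\<i> * of_real (\<omega>' / 2 ^ (k + 1))))" for k :: nat
    have norm: "cmod (u k) = 1" "cmod (v k) = 1" for k by (simp_all add: u_def v_def)
    then have nz: "u k \<noteq> 0" "v k \<noteq> 0" for k by (metis norm_zero zero_neq_one)+
    have uv: "cmod (u k - v k) \<le> 4 * (1/2) ^ k" for k
    proof -
      have "cmod (u k - v k) \<le> \<bar>- (\<omega> / 2 ^ (k + 1)) - - (\<omega>' / 2 ^ (k + 1))\<bar>"
        using norm_iexp_diff_le[of "- (\<omega> / 2 ^ (k + 1))" "- (\<omega>' / 2 ^ (k + 1))"] by (simp add: u_def v_def)
      also have "- (\<omega> / 2 ^ (k + 1)) - - (\<omega>' / 2 ^ (k + 1)) = - ((\<omega> - \<omega>') / 2 ^ (k + 1))"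
        by (simp add: diff_divide_distrib)
      also have "\<bar>- ((\<omega> - \<omega>') / 2 ^ (k + 1))\<bar> = \<bar>\<omega> - \<omega>'\<bar> / 2 ^ (k + 1)" by simp
      also have "\<dots> \<le> 8 / 2 ^ (k + 1)"
        using \<omega>'(1) pi_less_4 by (intro divide_right_mono) auto
      also have "\<dots> = 4 * (1/2) ^ k" by (simp add: power_one_over)
      finally show ?thesis .
    qed
    define S where "S N = cmod (\<Prod>k<N. symbol (a (k + m)) (u k) / 2)" for N
    define SD where "SD N = cmod (\<Prod>k<N. symbol (d k) (v k) / 2)" for N
    define E where "E j N = cmod (\<Prod>k<N. (u k + of_real (exp (- (\<tau> j / 2 ^ (k + 1))))) / 2)" for j N
    define ED where "ED N = cmod (\<Prod>k<N. (v k + 1) / 2)" for N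
    define c where "c = (2 :: real) ^ (2 * n - 1)"
    have S: "S N = (\<Prod>j<2 * n. E j N) * c ^ N * (\<Prod>k<N. cmod (poly (B (k + m)) (u k)))" for N
      unfolding S_def E_def c_def
    proof (rule norm_prod_symbol[OF _ norm(1) n])
      fix k
      have "lam j / 2 ^ (k + m + 1) = \<tau> j / 2 ^ (k + 1)" for j
        by (simp add: \<tau>_def power_add mult_ac)
      then show "symbol (a (k + m)) (u k) * u k ^ (2 * n - 1) =
        (\<Prod>j<2 * n. u k + of_real (exp (- (\<tau> j / 2 ^ (k + 1))))) * poly (B (k + m)) (u k)"
        using fac[OF nz(1), of "k + m" k] by simp
    qed
    have SD: "SD N = ED N ^ (2 * n) * c ^ N * (\<Prod>k<N. cmod (poly (dd_cofactor n) (v k)))" for N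
    proof -
      have "SD N = (\<Prod>j<2 * n. ED N) * c ^ N * (\<Prod>k<N. cmod (poly (dd_cofactor n) (v k)))"
        unfolding SD_def ED_def c_def by (rule norm_prod_symbol[OF facD[OF nz(2)] norm(2) n])
      then show ?thesis by simp
    qed
    \<comment> \<open>The powers of \<open>c\<close>, which diverge separately, stand on both sides
      and never have to be estimated.\<close>
    have main: "S N * ED N ^ (2 * n) \<le> Q * (\<Prod>j<2 * n. E j N) * SD N" for N
    proof -
      have "S N * ED N ^ (2 * n) \<le> ((\<Prod>j<2 * n. E j N) * c ^ N * (Q * (\<Prod>k<N. cmod (poly (dd_cofactor n) (v k))))) * ED N ^ (2 * n)"
        unfolding S using Q(2)[where u = u and v = v and N = N] norm uv
        by (intro mult_right_mono mult_left_mono mult_nonneg_nonneg prod_nonneg)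
           (auto simp: E_def ED_def c_def intro!: zero_le_power)
      then show ?thesis unfolding SD by (simp add: mult_ac)
    qed
    have Slim: "S \<longlonglongrightarrow> cmod (fourier \<Phi> \<omega>)"
      unfolding S_def u_def
      by (intro tendsto_norm basic_limit_function_fourier(3)[where R = "2 * int n - 1", OF _ _ \<Phi>])
         (use n interpolatory_mask_support[OF a] in auto)
    have "is_interpolatory_scheme n (\<lambda>_. 0) d" using dd by (simp add: is_Deslauriers_Dubuc_scheme_def)
    note supp_d = interpolatory_mask_support[OF this]
    have SDlim: "SD \<longlonglongrightarrow> cmod (fourier \<Phi>D \<omega>')"
      unfolding SD_def v_def
      by (intro tendsto_norm basic_limit_function_fourier(3)[where R = "2 * int n - 1", OF _ _ \<Phi>D])
         (use n supp_d in auto)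
    define e where "e j = cmod ((exp (- (\<i> * of_real \<omega>)) - exp (of_real (- \<tau> j))) / (- (\<i> * of_real \<omega>) - of_real (- \<tau> j)))" for j
    have Elim: "E j \<longlonglongrightarrow> e j" for j
    proof -
      have ne: "- (\<i> * complex_of_real \<omega>) \<noteq> of_real (- \<tau> j)"
        using \<omega> by (auto simp: complex_eq_iff)
      have "E j = (\<lambda>N. cmod (\<Prod>k<N. (exp (- (\<i> * of_real \<omega>) / 2 ^ (k + 1)) + exp (of_real (- \<tau> j) / 2 ^ (k + 1))) / 2))"
        by (simp add: E_def[abs_def] u_def flip: exp_of_real)
      then show ?thesis
        unfolding e_def using tendsto_norm[OF prod_exp_mean_tendsto[OF ne]] by simp
    qed
    have EDlim: "ED \<longlonglongrightarrow> 2 / \<bar>\<omega>'\<bar>"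
    proof -
      have ne: "- (\<i> * complex_of_real \<omega>') \<noteq> 0" using \<omega>' by auto
      have "ED = (\<lambda>N. cmod (\<Prod>k<N. (exp (- (\<i> * of_real \<omega>') / 2 ^ (k + 1)) + exp (0 / 2 ^ (k + 1))) / 2))"
        by (simp add: ED_def[abs_def] v_def)
      \<comment> \<open>At an odd multiple of pi the numerator is exactly -2, the largest modulus it
        can have.\<close>
      moreover have "cmod ((exp (- (\<i> * of_real \<omega>')) - exp 0) / (- (\<i> * of_real \<omega>') - 0)) = 2 / \<bar>\<omega>'\<bar>"
        using \<omega>'(2) by (simp add: norm_divide norm_mult)
      ultimately show ?thesis
        using tendsto_norm[OF prod_exp_mean_tendsto[OF ne]] by simp
    qed
    have "(\<lambda>N. S N * ED N ^ (2 * n)) \<longlonglongrightarrow> cmod (fourier \<Phi> \<omega>) * (2 / \<bar>\<omega>'\<bar>) ^ (2 * n)"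
      by (intro tendsto_intros Slim EDlim)
    moreover have "(\<lambda>N. Q * (\<Prod>j<2 * n. E j N) * SD N) \<longlonglongrightarrow> Q * (\<Prod>j<2 * n. e j) * cmod (fourier \<Phi>D \<omega>')"
      by (intro tendsto_intros SDlim Elim)
    ultimately have lim: "cmod (fourier \<Phi> \<omega>) * (2 / \<bar>\<omega>'\<bar>) ^ (2 * n) \<le> Q * (\<Prod>j<2 * n. e j) * cmod (fourier \<Phi>D \<omega>')"
      by (rule LIMSEQ_le) (use main in blast)
    have "(\<Prod>j<2 * n. e j) \<le> (\<Prod>j<2 * n. (1 + exp (- \<tau> j)) / \<bar>\<omega>\<bar>)"
    proof (intro prod_mono conjI)
      fix j
      show "0 \<le> e j" by (simp add: e_def)
      have "cmod (exp (- (\<i> * of_real \<omega>)) - exp (of_real (- \<tau> j))) \<le> 1 + exp (- \<tau> j)"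
        by (rule order_trans[OF norm_triangle_ineq4]) simp
      \<comment> \<open>The imaginary part alone gives |\<open>\<omega>\<close>|, for every real
        \<open>\<tau> j\<close>, zero or not.\<close>
      moreover have "\<bar>\<omega>\<bar> \<le> cmod (- (\<i> * of_real \<omega>) - of_real (- \<tau> j))"
        using abs_Im_le_cmod[of "- (\<i> * of_real \<omega>) - of_real (- \<tau> j)"] by simp
      ultimately show "e j \<le> (1 + exp (- \<tau> j)) / \<bar>\<omega>\<bar>"
        unfolding e_def norm_divide using \<omega> by (intro frac_le) auto
    qed
    also have "\<dots> = G / \<bar>\<omega>\<bar> ^ (2 * n)" by (simp add: G_def prod_dividef)
    finally have e: "(\<Prod>j<2 * n. e j) \<le> G / \<bar>\<omega>\<bar> ^ (2 * n)" .
    have "cmod (fourier \<Phi> \<omega>) = (cmod (fourier \<Phi> \<omega>) * (2 / \<bar>\<omega>'\<bar>) ^ (2 * n)) * (\<bar>\<omega>'\<bar> / 2) ^ (2 * n)"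
      using \<omega>'(3) by (simp add: power_divide)
    also have "\<dots> \<le> (Q * (G / \<bar>\<omega>\<bar> ^ (2 * n)) * cmod (fourier \<Phi>D \<omega>')) * (\<bar>\<omega>'\<bar> / 2) ^ (2 * n)"
      using Q(1) e by (intro mult_right_mono order_trans[OF lim] mult_left_mono) auto
    also have "\<dots> = (Q * G * (\<bar>\<omega>'\<bar> / \<bar>\<omega>\<bar> / 2) ^ (2 * n)) * cmod (fourier \<Phi>D \<omega>')"
      by (simp add: power_divide mult_ac)
    also have "\<dots> \<le> (Q * G * (5/2) ^ (2 * n)) * cmod (fourier \<Phi>D \<omega>')"
    proof (intro mult_right_mono mult_left_mono power_mono)
      have "\<bar>\<omega>'\<bar> \<le> 5 * \<bar>\<omega>\<bar>" using \<omega>'(1) pi_less_4 \<omega> by linarith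
      then show "\<bar>\<omega>'\<bar> / \<bar>\<omega>\<bar> / 2 \<le> 5/2" using \<omega> by (simp add: field_simps)
    qed (use Q(1) G in auto)
    finally show ?thesis using \<omega>'(1) by blast
  qed
  then show ?thesis using Q(1) G by (intro that[of "Q * G * (5/2) ^ (2 * n)"]) auto
qed

theorem theorem22:
  fixes n l :: nat and lam :: "nat \<Rightarrow> real" and \<alpha> \<epsilon> C :: real
    and d a :: "nat \<Rightarrow> int \<Rightarrow> complex" and \<Phi>D :: "real \<Rightarrow> complex"
  assumes "n \<ge> 1"
    and "0 \<le> \<alpha>" and "\<alpha> < 1"
    and "is_Deslauriers_Dubuc_scheme n d"
    and "is_basic_limit_function d \<Phi>D"
    and "\<epsilon> > 0" and "C > 0"
    and "\<forall>\<omega>. cmod (fourier \<Phi>D \<omega>) \<le> C * (\<bar>\<omega>\<bar> + 1) powr (- real l - 1 - \<alpha> - \<epsilon>)"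
    and "is_interpolatory_scheme n lam a"
  shows "\<forall>m \<Phi>. is_basic_limit_function (\<lambda>k. a (k + m)) \<Phi> \<longrightarrow>
           (\<exists>g. has_nth_derivative l \<Phi> g \<and> g \<in> Lip \<alpha>)"
proof (intro allI impI)
  fix m \<Phi> assume \<Phi>: "is_basic_limit_function (\<lambda>k. a (k + m)) \<Phi>"
  define r where "r = real l + 1 + \<alpha> + \<epsilon>"
  have r: "r > 0" "- real l - 1 - \<alpha> - \<epsilon> = - r" using assms by (auto simp: r_def)
  obtain H where H: "H > 0" "\<And>\<omega>. \<bar>\<omega>\<bar> \<ge> 1 \<Longrightarrow>
     \<exists>\<omega>'. \<bar>\<omega> - \<omega>'\<bar> \<le> pi \<and> cmod (fourier \<Phi> \<omega>) \<le> H * cmod (fourier \<Phi>D \<omega>')"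
    using fourier_decay_transfer[OF assms(1,4,5,9) \<Phi>] by blast
  define I where "I = (LINT x|lborel. cmod (\<Phi> x))"
  have I: "I \<ge> 0" unfolding I_def by simp
  \<comment> \<open>The transfer covers |\<open>\<omega>\<close>| >= 1 only; below that the L1 norm
    \<open>I\<close> bounds the transform. Adding the two constants gives one majorant for both
    ranges.\<close>
  have decay: "cmod (fourier \<Phi> \<omega>) \<le> (I * 2 powr r + H * C * 5 powr r) * (\<bar>\<omega>\<bar> + 1) powr (- r)" for \<omega>
  proof (cases "\<bar>\<omega>\<bar> \<ge> 1")
    case True
    obtain \<omega>' where \<omega>': "\<bar>\<omega> - \<omega>'\<bar> \<le> pi" "cmod (fourier \<Phi> \<omega>) \<le> H * cmod (fourier \<Phi>D \<omega>')"
      using H(2)[OF True] by blast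
    have "\<bar>\<omega>\<bar> \<le> \<bar>\<omega>'\<bar> + 4" using \<omega>'(1) pi_less_4 by linarith
    \<comment> \<open>Here |\<open>\<omega>\<close>| + 1 <= |\<open>\<omega>'\<close>| + 5 <= 5
      (|\<open>\<omega>'\<close>| + 1), so the shift of frequency costs the factor 5^r.\<close>
    then have "(\<bar>\<omega>\<bar> + 1) / 5 \<le> \<bar>\<omega>'\<bar> + 1" using abs_ge_zero[of \<omega>'] by simp
    then have "(\<bar>\<omega>'\<bar> + 1) powr (- r) \<le> ((\<bar>\<omega>\<bar> + 1) / 5) powr (- r)"
      using r by (intro powr_mono2') auto
    also have "\<dots> = 5 powr r * (\<bar>\<omega>\<bar> + 1) powr (- r)"
      by (simp add: powr_divide powr_minus field_simps)
    finally have shift: "(\<bar>\<omega>'\<bar> + 1) powr (- r) \<le> 5 powr r * (\<bar>\<omega>\<bar> + 1) powr (- r)" .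
    have "cmod (fourier \<Phi> \<omega>) \<le> H * (C * (\<bar>\<omega>'\<bar> + 1) powr (- r))"
      using assms(8) H(1) unfolding r(2) by (intro order_trans[OF \<omega>'(2)] mult_left_mono) auto
    also have "\<dots> \<le> H * (C * (5 powr r * (\<bar>\<omega>\<bar> + 1) powr (- r)))"
      using H(1) \<open>C > 0\<close> shift by (intro mult_left_mono) auto
    also have "\<dots> \<le> I * 2 powr r * (\<bar>\<omega>\<bar> + 1) powr (- r) + \<dots>" using I by simp
    finally show ?thesis by (simp add: algebra_simps)
  next
    case False
    have "cmod (fourier \<Phi> \<omega>) \<le> I * 1" unfolding I_def using norm_fourier_le by simp
    also have "1 \<le> 2 powr r * (\<bar>\<omega>\<bar> + 1) powr (- r)"
    proof -
      \<comment> \<open>For |\<open>\<omega>\<close>| < 1 the base stays below 2, so the factor 2^r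
        lifts the majorant to at least 1.\<close>
      have "2 powr (- r) \<le> (\<bar>\<omega>\<bar> + 1) powr (- r)"
        using False r by (intro powr_mono2') auto
      then have "2 powr r * 2 powr (- r) \<le> 2 powr r * (\<bar>\<omega>\<bar> + 1) powr (- r)"
        by (rule mult_left_mono) simp
      then show ?thesis by (simp flip: powr_add)
    qed
    then have "I * 1 \<le> I * (2 powr r * (\<bar>\<omega>\<bar> + 1) powr (- r))" using I by (rule mult_left_mono)
    also have "\<dots> \<le> \<dots> + H * C * 5 powr r * (\<bar>\<omega>\<bar> + 1) powr (- r)"
      using H(1) \<open>C > 0\<close> by simp
    finally show ?thesis by (simp add: algebra_simps)
  qed
  have supp: "a (k + m) j = 0" if "\<bar>j\<bar> > 2 * int n - 1" for k j
    using interpolatory_mask_support[OF assms(9) that] .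
  have R: "2 * int n - 1 \<ge> 1" using assms(1) by simp
  show "\<exists>g. has_nth_derivative l \<Phi> g \<and> g \<in> Lip \<alpha>"
    by (rule fourier_decay_imp_Lip_derivative[where R = "of_int (2 * int n - 1)" and \<epsilon> = \<epsilon>,
          OF basic_limit_function_fourier(1,2)[OF supp R \<Phi>] assms(2,3,6) decay[folded r(2)]])
qed

end
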